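(* Let $n,p$ be integers with either $n \geq 2$ and $p \geq 4$, or $n \geq 3$ and $p=3$. Let $G=\mathrm{GL}_p(\mathbb{C})$ act on $\mathcal{M}_p^n$ by simultaneous conjugation. Then $\mathbb{C}[\mathcal{M}_p^n]^G$ contains neither a polynomial separating set nor a hypersurface separating set.
   Context: $\mathcal{M}_p$ is the space of complex $p\times p$ matrices, $\mathcal{V}=\mathcal{M}_p^n$, and $g\cdot(A_1,\dots,A_n)=(gA_1g^{-1},\dots,gA_ng^{-1})$. A subset $S \subseteq \mathbb{C}[\mathcal{V}]^G$ is a separating set if for all $v,w\in\mathcal{V}$: $s(v)=s(w)$ for all $s\in S$ iff $f(v)=f(w)$ for all $f\in\mathbb{C}[\mathcal{V}]^G$. A polynomial separating set is a separating set of cardinality $\dim(\mathbb{C}[\mathcal{V}]^G)$ (Krull dimension), and a hypersurface separating set is a separating set of cardinality $\dim(\mathbb{C}[\mathcal{V}]^G)+1$. *)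

theory Defs
  imports "HOL-Analysis.Analysis" "HOL-Library.Extended_Nat" "HOL-Algebra.Ideal"
begin

text \<open>
  The space of \<open>n\<close>-tuples of complex \<open>p \<times> p\<close> matrices, with \<open>n = CARD('n)\<close> and \<open>p = CARD('p)\<close>.
\<close>

type_synonym ('p, 'n) mat_tuple = "((complex ^ 'p) ^ 'p) ^ 'n"

definition general_linear_group :: "((complex ^ 'p) ^ 'p) set" where
  "general_linear_group = {g. invertible g}"

definition conj_action ::
    "(complex ^ 'p) ^ 'p \<Rightarrow> ('p::finite, 'n::finite) mat_tuple \<Rightarrow> ('p, 'n) mat_tuple" where
  "conj_action g A = (\<chi> k. g ** (A $ k) ** matrix_inv g)"

text \<open>
  The coordinate ring is taken as the ring of polynomial functions. Since the complex field is
  infinite, this is the polynomial ring in the matrix entries.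
\<close>

inductive_set polynomial_functions :: "(('p::finite, 'n::finite) mat_tuple \<Rightarrow> complex) set" where
  const: "(\<lambda>A. c) \<in> polynomial_functions"
| entry: "(\<lambda>A. A $ k $ i $ j) \<in> polynomial_functions"
| add: "f \<in> polynomial_functions \<Longrightarrow> h \<in> polynomial_functions \<Longrightarrow>
    (\<lambda>A. f A + h A) \<in> polynomial_functions"
| mult: "f \<in> polynomial_functions \<Longrightarrow> h \<in> polynomial_functions \<Longrightarrow>
    (\<lambda>A. f A * h A) \<in> polynomial_functions"

definition invariants :: "(('p::finite, 'n::finite) mat_tuple \<Rightarrow> complex) set" where
  "invariants = {f \<in> polynomial_functions.
     \<forall>g \<in> general_linear_group. \<forall>A. f (conj_action g A) = f A}"

definition invariant_ring :: "(('p::finite, 'n::finite) mat_tuple \<Rightarrow> complex) ring" where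
  "invariant_ring = \<lparr>carrier = invariants,
     monoid.mult = (\<lambda>f h A. f A * h A), one = (\<lambda>A. 1),
     zero = (\<lambda>A. 0), ring.add = (\<lambda>f h A. f A + h A)\<rparr>"

lemma cring_invariant_ring:
  "cring (invariant_ring :: (('p::finite, 'n::finite) mat_tuple \<Rightarrow> complex) ring)"
proof (rule cringI)
  show "abelian_group (invariant_ring :: (('p, 'n) mat_tuple \<Rightarrow> complex) ring)"
  proof (rule abelian_groupI)
    fix f :: "('p, 'n) mat_tuple \<Rightarrow> complex"
    assume "f \<in> carrier invariant_ring"
    then have "(\<lambda>A. - f A) \<in> carrier invariant_ring"
      using polynomial_functions.mult[OF polynomial_functions.const[of "- 1"], of f]
      by (auto simp: invariant_ring_def invariants_def)
    then show "\<exists>h\<in>carrier invariant_ring. h \<oplus>\<^bsub>invariant_ring\<^esub> f = \<zero>\<^bsub>invariant_ring\<^esub>"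
      by (rule bexI[rotated]) (simp add: invariant_ring_def)
  qed (auto simp: invariant_ring_def invariants_def algebra_simps
      intro: polynomial_functions.intros)
  show "Group.comm_monoid (invariant_ring :: (('p, 'n) mat_tuple \<Rightarrow> complex) ring)"
    by (rule comm_monoidI) (auto simp: invariant_ring_def invariants_def algebra_simps
        intro: polynomial_functions.intros)
qed (auto simp: invariant_ring_def algebra_simps)

text \<open>
  Krull dimension: the supremum of the lengths \<open>k\<close> of chains \<open>P 0 \<subset> P 1 \<subset> \<dots> \<subset> P k\<close> of prime
  ideals (the zero ring gets dimension 0 here).
\<close>

definition krull_dim :: "('a, 'b) ring_scheme \<Rightarrow> enat" where
  "krull_dim R = Sup {enat k | k.
     \<exists>P :: nat \<Rightarrow> 'a set. (\<forall>i\<le>k. primeideal (P i) R) \<and> (\<forall>i<k. P i \<subset> P (Suc i))}"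

definition separating_set :: "(('p::finite, 'n::finite) mat_tuple \<Rightarrow> complex) set \<Rightarrow> bool" where
  "separating_set S \<longleftrightarrow> S \<subseteq> invariants \<and>
     (\<forall>v w. (\<forall>s\<in>S. s v = s w) \<longleftrightarrow> (\<forall>f\<in>invariants. f v = f w))"

definition polynomial_separating_set ::
    "(('p::finite, 'n::finite) mat_tuple \<Rightarrow> complex) set \<Rightarrow> bool" where
  "polynomial_separating_set S \<longleftrightarrow> separating_set S \<and> finite S \<and>
     enat (card S) = krull_dim (invariant_ring :: (('p, 'n) mat_tuple \<Rightarrow> complex) ring)"

definition hypersurface_separating_set ::
    "(('p::finite, 'n::finite) mat_tuple \<Rightarrow> complex) set \<Rightarrow> bool" where
  "hypersurface_separating_set S \<longleftrightarrow> separating_set S \<and> finite S \<and>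
     enat (card S) = krull_dim (invariant_ring :: (('p, 'n) mat_tuple \<Rightarrow> complex) ring) + 1"

end

theory Submission
  imports Defs "HOL-Computational_Algebra.Fundamental_Theorem_Algebra"
begin

text \<open>
  Write \<open>n\<close> for the number and \<open>p\<close> for the size of the matrices. An invariant is determined by its
  restriction to an affine space of dimension \<open>(n - 1) p\<^sup>2 + 1\<close>, which bounds the Krull dimension.
  A separating set \<open>S\<close> cuts out the set of pairs with equal invariants by the \<open>card S\<close>
  equations \<open>s v = s w\<close>. This set has a component of codimension \<open>(n - 1) p\<^sup>2 + 3\<close>: pairs of block
  upper triangular tuples with blocks of sizes \<open>1, p - 2, 1\<close> in the same order and with equal
  diagonal blocks. We exhibit an affine space of pairs of dimension \<open>(n - 1) p\<^sup>2 + 3\<close> that meets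
  the set in a single point. Since fewer equations than variables cannot have exactly one common
  zero, \<open>card S\<close> is at least the Krull dimension plus two. The hypothesis on \<open>n\<close> and \<open>p\<close> says
  \<open>(n - 1) (p - 2) \<ge> 2\<close>, that is, the extensions between neighbouring blocks are not all proportional.
\<close>

section \<open>Polynomial functions and common zeros\<close>

text \<open>The number \<open>3\<close> in the codimension is the number of blocks. A simple block
  of size \<open>q\<close> has \<open>(n - 1) q^2 + 1\<close> independent invariants, and these have
  to agree for the two tuples. In both tuples the entries below the blocks have to vanish up to the
  choice of a flag, which supplies the mixed terms of \<open>(n - 1) p^2\<close>. With
  \<open>r\<close> blocks the codimension is \<open>(n - 1) p^2 + r\<close>: one block gives the
  Krull dimension, two blocks would exclude only polynomial separating sets, and three blocks
  exclude hypersurface separating sets as well. The obstacle is to show that the slice meets the set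
  in one point only. For this one matrix of both tuples is forced to be the same diagonal matrix
  with distinct entries. Traces of words then reveal products of matrix entries along closed walks
  on the indices, and equality of invariants becomes a system of equations between such products.
  Walks of length at most three are enough to solve it.\<close>

lemma nontrivial_linear_relation:
  fixes M :: "'a \<Rightarrow> 'b \<Rightarrow> 'f::field"
  assumes "finite B" "finite A" "card B < card A"
  shows "\<exists>c. (\<exists>a\<in>A. c a \<noteq> 0) \<and> (\<forall>b\<in>B. (\<Sum>a\<in>A. c a * M a b) = 0)"
  using assms
proof (induction B arbitrary: A M rule: finite_induct)
  case empty
  then obtain a where "a \<in> A" by fastforce
  then show ?case by (intro exI[of _ "\<lambda>_. 1"]) auto
next
  case (insert b B)
  show ?case
  proof (cases "\<forall>a\<in>A. M a b = 0")
    case True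
    have "card B < card A" using insert.prems insert.hyps by simp
    from insert.IH[OF insert.prems(1) this, of M] True show ?thesis by auto
  next
    case False
    then obtain a0 where a0: "a0 \<in> A" "M a0 b \<noteq> 0" by auto
    \<comment> \<open>Gaussian elimination with pivot \<open>a0\<close>: the modified coefficients
      vanish at \<open>b\<close>, and the coefficient of \<open>a0\<close> is restored at the end so
      that the equation for \<open>b\<close> holds.\<close>
    let ?M = "\<lambda>a b'. M a b' - M a b / M a0 b * M a0 b'"
    have "finite (A - {a0})" "card B < card (A - {a0})"
      using insert.prems insert.hyps a0 by (simp_all add: card_Diff_singleton)
    from insert.IH[OF this, of ?M] obtain c where
      c: "\<exists>a\<in>A - {a0}. c a \<noteq> 0" "\<forall>b'\<in>B. (\<Sum>a\<in>A - {a0}. c a * ?M a b') = 0" by blast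
    define s where "s = (\<Sum>a\<in>A - {a0}. c a * M a b / M a0 b)"
    have split: "(\<Sum>a\<in>A. (c(a0 := - s)) a * M a b') = (\<Sum>a\<in>A - {a0}. c a * M a b') - s * M a0 b'" for b'
      using insert.prems(1) a0 by (simp add: sum.remove)
    have "(\<Sum>a\<in>A. (c(a0 := - s)) a * M a b') = 0" if "b' \<in> insert b B" for b'
    proof (cases "b' = b")
      case True
      have "s * M a0 b = (\<Sum>a\<in>A - {a0}. c a * M a b)"
        unfolding s_def sum_distrib_right using a0 by (intro sum.cong) auto
      then show ?thesis unfolding split True by simp
    next
      case False
      then have "(\<Sum>a\<in>A - {a0}. c a * ?M a b') = 0" using c(2) that by blast
      then have "(\<Sum>a\<in>A - {a0}. c a * M a b') = s * M a0 b'"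
        unfolding s_def by (simp add: algebra_simps sum_subtractf sum_distrib_left sum_distrib_right)
      then show ?thesis unfolding split by simp
    qed
    moreover have "\<exists>a\<in>A. (c(a0 := - s)) a \<noteq> 0" using c(1) by auto
    ultimately show ?thesis by blast
  qed
qed

section \<open>Polynomial functions in a set of variables, and independence of monomials\<close>

lemma poly_eq_if_eq_infinite:
  fixes p q :: "complex poly"
  assumes "finite E" "\<And>t. t \<notin> E \<Longrightarrow> poly p t = poly q t"
  shows "p = q"
proof (rule ccontr)
  assume "p \<noteq> q"
  then have "finite {t. poly (p - q) t = 0}" by (intro poly_roots_finite) auto
  moreover have "UNIV \<subseteq> E \<union> {t. poly (p - q) t = 0}" using assms(2) by auto
  ultimately have "finite (UNIV :: complex set)" using assms(1) by (meson finite_UnI finite_subset)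
  then show False using infinite_UNIV_char_0 by blast
qed

text \<open>Points are total functions and only the coordinates in \<open>I\<close> may occur. The
  number of variables is thus the cardinality of a set, which can be compared with a number of
  equations, and is not fixed by a type.\<close>

inductive_set poly_funs :: "'v set \<Rightarrow> (('v \<Rightarrow> complex) \<Rightarrow> complex) set" for I where
  const: "(\<lambda>x. c) \<in> poly_funs I"
| var: "i \<in> I \<Longrightarrow> (\<lambda>x. x i) \<in> poly_funs I"
| add: "f \<in> poly_funs I \<Longrightarrow> g \<in> poly_funs I \<Longrightarrow> (\<lambda>x. f x + g x) \<in> poly_funs I"
| mult: "f \<in> poly_funs I \<Longrightarrow> g \<in> poly_funs I \<Longrightarrow> (\<lambda>x. f x * g x) \<in> poly_funs I"

lemma poly_funs_minus:
  assumes "f \<in> poly_funs I" "g \<in> poly_funs I"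
  shows "(\<lambda>x. f x - g x) \<in> poly_funs I"
  using poly_funs.add[OF assms(1) poly_funs.mult[OF poly_funs.const[of "-1"] assms(2)]] by simp

lemma poly_funs_sum:
  "finite A \<Longrightarrow> (\<And>a. a \<in> A \<Longrightarrow> f a \<in> poly_funs I) \<Longrightarrow> (\<lambda>x. \<Sum>a\<in>A. f a x) \<in> poly_funs I"
  by (induction A rule: finite_induct) (auto intro: poly_funs.intros)

lemma poly_funs_prod:
  "finite A \<Longrightarrow> (\<And>a. a \<in> A \<Longrightarrow> f a \<in> poly_funs I) \<Longrightarrow> (\<lambda>x. \<Prod>a\<in>A. f a x) \<in> poly_funs I"
  by (induction A rule: finite_induct) (auto intro: poly_funs.intros)

lemma poly_funs_power: "f \<in> poly_funs I \<Longrightarrow> (\<lambda>x. f x ^ k) \<in> poly_funs I"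
  by (induction k) (auto intro: poly_funs.intros)

definition monom_fun :: "'v set \<Rightarrow> ('v \<Rightarrow> nat) \<Rightarrow> ('v \<Rightarrow> complex) \<Rightarrow> complex" where
  "monom_fun I \<beta> x = (\<Prod>i\<in>I. x i ^ \<beta> i)"

lemma monom_fun_poly: "finite I \<Longrightarrow> monom_fun I \<beta> \<in> poly_funs I"
  unfolding monom_fun_def by (auto intro!: poly_funs_prod poly_funs_power poly_funs.var)

lemma monom_fun_add: "monom_fun I \<beta> x * monom_fun I \<gamma> x = monom_fun I (\<lambda>i. \<beta> i + \<gamma> i) x"
  by (simp add: monom_fun_def power_add prod.distrib)

lemma monom_fun_cong: "(\<And>i. i \<in> I \<Longrightarrow> \<beta> i = \<gamma> i) \<Longrightarrow> monom_fun I \<beta> = monom_fun I \<gamma>"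
  unfolding monom_fun_def fun_eq_iff by (auto intro!: prod.cong)

lemma monom_fun_upd:
  assumes "finite I" "i \<in> I"
  shows "monom_fun I \<beta> x = x i ^ \<beta> i * monom_fun (I - {i}) \<beta> x"
  using assms unfolding monom_fun_def by (simp add: prod.remove)

text \<open>Comparison of coefficients, one variable at a time: with the other variables fixed, the
  sum is a univariate polynomial in \<open>x i\<close>, and its coefficient at
  \<open>\<beta>0 i\<close> is a relation in fewer variables. A monomial sees its exponents on
  \<open>I\<close> only, so the exponents have to be distinct there.\<close>

lemma monom_fun_independent:
  assumes "finite I" "finite B" "inj_on (\<lambda>\<beta>. restrict \<beta> I) B"
    and "\<And>x. (\<Sum>\<beta>\<in>B. c \<beta> * monom_fun I \<beta> x) = 0"
  shows "\<forall>\<beta>\<in>B. c \<beta> = 0"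
  using assms
proof (induction I arbitrary: B rule: finite_induct)
  case empty
  show ?case
  proof
    fix \<beta> assume "\<beta> \<in> B"
    then have "B = {\<beta>}" using empty.prems(2) by (auto simp: inj_on_def)
    then show "c \<beta> = 0" using empty.prems(3) by (simp add: monom_fun_def)
  qed
next
  case (insert i I)
  have "c \<beta>0 = 0" if b0: "\<beta>0 \<in> B" for \<beta>0
  proof -
    define B' where "B' = {\<beta> \<in> B. \<beta> i = \<beta>0 i}"
    have "(\<Sum>\<beta>\<in>B'. c \<beta> * monom_fun I \<beta> x) = 0" for x
    proof -
      define q where "q = (\<Sum>\<beta>\<in>B. monom (c \<beta> * monom_fun I \<beta> x) (\<beta> i))"
      have "poly q t = 0" for t
      proof -
        have eq: "monom_fun (insert i I) \<beta> (x(i := t)) = t ^ \<beta> i * monom_fun I \<beta> x" for \<beta>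
        proof -
          have "(\<Prod>j\<in>I. (x(i := t)) j ^ \<beta> j) = (\<Prod>j\<in>I. x j ^ \<beta> j)"
            using insert.hyps(2) by (intro prod.cong) auto
          then show ?thesis using insert.hyps by (simp add: monom_fun_def)
        qed
        show ?thesis using insert.prems(3)[of "x(i := t)"] unfolding eq
          by (simp add: q_def poly_sum poly_monom mult.commute mult.left_commute)
      qed
      then have "q = 0" using poly_all_0_iff_0 by blast
      then have "coeff q (\<beta>0 i) = 0" by simp
      then show ?thesis
        using insert.prems(1) by (simp add: q_def coeff_sum B'_def sum.inter_filter)
    qed
    moreover have "inj_on (\<lambda>\<beta>. restrict \<beta> I) B'"
    proof (rule inj_onI)
      fix \<beta> \<gamma> assume h: "\<beta> \<in> B'" "\<gamma> \<in> B'" "restrict \<beta> I = restrict \<gamma> I"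
      then have "restrict \<beta> (insert i I) = restrict \<gamma> (insert i I)"
        by (simp add: B'_def restrict_def fun_eq_iff) metis
      then show "\<beta> = \<gamma>"
        by (rule inj_onD[OF insert.prems(2)]) (use h in \<open>simp_all add: B'_def\<close>)
    qed
    moreover have "finite B'" using insert.prems(1) by (simp add: B'_def)
    ultimately have "\<forall>\<beta>\<in>B'. c \<beta> = 0" using insert.IH[of B'] by blast
    then show ?thesis using b0 by (simp add: B'_def)
  qed
  then show ?case by blast
qed

lemma inj_on_restrict_PiE: "inj_on (\<lambda>\<beta>. restrict \<beta> I) (I \<rightarrow>\<^sub>E E)"
  by (auto simp: inj_on_def PiE_restrict)

section \<open>Finite-dimensional spaces of functions, and polynomials of bounded degree in each
  variable\<close>

definition lin_span :: "('a \<Rightarrow> 'b \<Rightarrow> complex) \<Rightarrow> 'a set \<Rightarrow> ('b \<Rightarrow> complex) set" where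
  "lin_span b X = {f. \<exists>c. f = (\<lambda>x. \<Sum>a\<in>X. c a * b a x)}"

lemma lin_span_base:
  assumes "finite X" "a \<in> X"
  shows "b a \<in> lin_span b X"
proof -
  have "b a x = (\<Sum>a'\<in>X. (if a' = a then 1 else 0) * b a' x)" for x
    using sum.delta[of X a "\<lambda>a'. b a' x"] assms
    by (simp only: if_distrib[of "\<lambda>z. z * _"] mult_1_left mult_zero_left) simp
  then have "b a = (\<lambda>x. \<Sum>a'\<in>X. (if a' = a then 1 else 0) * b a' x)" by (intro ext)
  then show ?thesis unfolding lin_span_def by (intro CollectI exI)
qed

lemma lin_span_add:
  assumes "f \<in> lin_span b X" "g \<in> lin_span b X"
  shows "(\<lambda>x. f x + g x) \<in> lin_span b X"
proof -
  from assms obtain c d where "f = (\<lambda>x. \<Sum>a\<in>X. c a * b a x)" "g = (\<lambda>x. \<Sum>a\<in>X. d a * b a x)"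
    by (auto simp: lin_span_def)
  then have "(\<lambda>x. f x + g x) = (\<lambda>x. \<Sum>a\<in>X. (c a + d a) * b a x)"
    by (simp add: sum.distrib algebra_simps)
  then show ?thesis unfolding lin_span_def by (intro CollectI exI)
qed

lemma lin_span_scale:
  assumes "f \<in> lin_span b X"
  shows "(\<lambda>x. k * f x) \<in> lin_span b X"
proof -
  from assms obtain c where "f = (\<lambda>x. \<Sum>a\<in>X. c a * b a x)" by (auto simp: lin_span_def)
  then have "(\<lambda>x. k * f x) = (\<lambda>x. \<Sum>a\<in>X. (k * c a) * b a x)"
    by (simp add: sum_distrib_left algebra_simps)
  then show ?thesis unfolding lin_span_def by (intro CollectI exI)
qed

lemma lin_span_zero: "(\<lambda>x. 0) \<in> lin_span b X"
  unfolding lin_span_def by (auto intro!: exI[of _ "\<lambda>_. 0"])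

lemma lin_span_sum:
  "finite A \<Longrightarrow> (\<And>a. a \<in> A \<Longrightarrow> f a \<in> lin_span b X) \<Longrightarrow> (\<lambda>x. \<Sum>a\<in>A. f a x) \<in> lin_span b X"
  by (induction A rule: finite_induct) (auto intro: lin_span_zero lin_span_add)

lemma lin_span_dependent:
  assumes "finite X" "finite A" "card X < card A" "\<And>a. a \<in> A \<Longrightarrow> f a \<in> lin_span b X"
  shows "\<exists>c. (\<exists>a\<in>A. c a \<noteq> 0) \<and> (\<forall>x. (\<Sum>a\<in>A. c a * f a x) = 0)"
proof -
  have "\<forall>a. \<exists>m. a \<in> A \<longrightarrow> f a = (\<lambda>x. \<Sum>y\<in>X. m y * b y x)"
    using assms(4) unfolding lin_span_def by fast
  then obtain m where m: "\<And>a. a \<in> A \<Longrightarrow> f a = (\<lambda>x. \<Sum>y\<in>X. m a y * b y x)" by metis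
  obtain c where c: "\<exists>a\<in>A. c a \<noteq> 0" "\<forall>y\<in>X. (\<Sum>a\<in>A. c a * m a y) = 0"
    using nontrivial_linear_relation[OF assms(1-3), of m] by blast
  have "(\<Sum>a\<in>A. c a * f a x) = 0" for x
  proof -
    have "(\<Sum>a\<in>A. c a * f a x) = (\<Sum>a\<in>A. \<Sum>y\<in>X. (c a * m a y) * b y x)"
      by (simp add: m sum_distrib_left mult.assoc)
    also have "\<dots> = (\<Sum>y\<in>X. (\<Sum>a\<in>A. c a * m a y) * b y x)"
      by (subst sum.swap) (simp add: sum_distrib_right)
    also have "\<dots> = 0" using c(2) by simp
    finally show ?thesis .
  qed
  then show ?thesis using c(1) by blast
qed

text \<open>Each exponent is bounded separately, and not the total degree. The number of spanning
  monomials is then the pure power \<open>Suc d ^ card I\<close>, and the dimension counts below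
  compare powers.\<close>

definition box_poly :: "'v set \<Rightarrow> nat \<Rightarrow> (('v \<Rightarrow> complex) \<Rightarrow> complex) set" where
  "box_poly I d = lin_span (monom_fun I) (I \<rightarrow>\<^sub>E {..d})"

lemma finite_box: "finite I \<Longrightarrow> finite (I \<rightarrow>\<^sub>E {..d::nat})"
  by (simp add: finite_PiE)

lemma card_box: "finite I \<Longrightarrow> card (I \<rightarrow>\<^sub>E {..d::nat}) = Suc d ^ card I"
  by (simp add: card_PiE)

lemma box_poly_monom:
  assumes "finite I" "\<And>i. i \<in> I \<Longrightarrow> \<beta> i \<le> d"
  shows "monom_fun I \<beta> \<in> box_poly I d"
proof -
  have "restrict \<beta> I \<in> I \<rightarrow>\<^sub>E {..d}" using assms(2) by auto
  moreover have "monom_fun I \<beta> = monom_fun I (restrict \<beta> I)" by (rule monom_fun_cong) simp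
  ultimately show ?thesis
    unfolding box_poly_def by (metis lin_span_base finite_box[OF assms(1)])
qed

lemmas box_poly_add = lin_span_add[of _ "monom_fun I" "I \<rightarrow>\<^sub>E {..d}" for I d, folded box_poly_def]
lemmas box_poly_scale = lin_span_scale[of _ "monom_fun I" "I \<rightarrow>\<^sub>E {..d}" for I d, folded box_poly_def]
lemmas box_poly_sum = lin_span_sum[of _ _ "monom_fun I" "I \<rightarrow>\<^sub>E {..d}" for I d, folded box_poly_def]

lemma box_polyE:
  assumes "f \<in> box_poly I d"
  obtains c where "f = (\<lambda>x. \<Sum>\<beta>\<in>I \<rightarrow>\<^sub>E {..d}. c \<beta> * monom_fun I \<beta> x)"
  using assms by (auto simp: box_poly_def lin_span_def)

lemma box_poly_mult:
  assumes "finite I" "f \<in> box_poly I d" "g \<in> box_poly I e"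
  shows "(\<lambda>x. f x * g x) \<in> box_poly I (d + e)"
proof -
  obtain a b where
    ab: "f = (\<lambda>x. \<Sum>\<beta>\<in>I \<rightarrow>\<^sub>E {..d}. a \<beta> * monom_fun I \<beta> x)"
    "g = (\<lambda>x. \<Sum>\<beta>\<in>I \<rightarrow>\<^sub>E {..e}. b \<beta> * monom_fun I \<beta> x)"
    using assms(2,3) by (elim box_polyE)
  have "(\<lambda>x. f x * g x) = (\<lambda>x. \<Sum>\<beta>\<in>I \<rightarrow>\<^sub>E {..d}. \<Sum>\<gamma>\<in>I \<rightarrow>\<^sub>E {..e}.
          (a \<beta> * b \<gamma>) * monom_fun I (\<lambda>i. \<beta> i + \<gamma> i) x)"
    unfolding ab sum_product by (simp add: monom_fun_add[symmetric] algebra_simps)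
  also have "\<dots> \<in> box_poly I (d + e)"
    using assms(1)
    by (intro box_poly_sum finite_box box_poly_scale box_poly_monom)
       (auto simp: PiE_def Pi_def intro!: add_mono)
  finally show ?thesis .
qed

lemma box_poly_mono:
  assumes "finite I" "d \<le> e" "f \<in> box_poly I d"
  shows "f \<in> box_poly I e"
proof -
  obtain a where a: "f = (\<lambda>x. \<Sum>\<beta>\<in>I \<rightarrow>\<^sub>E {..d}. a \<beta> * monom_fun I \<beta> x)"
    using assms(3) by (elim box_polyE)
  show ?thesis unfolding a using assms(1,2)
    by (intro box_poly_sum finite_box box_poly_scale box_poly_monom)
       (auto simp: PiE_def Pi_def intro: order_trans)
qed

lemma box_poly_one: "finite I \<Longrightarrow> (\<lambda>x. 1) \<in> box_poly I d"
  using box_poly_monom[of I "\<lambda>_. 0" d] by (simp add: monom_fun_def[abs_def])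

lemma box_poly_power:
  assumes "finite I" "f \<in> box_poly I d"
  shows "(\<lambda>x. f x ^ k) \<in> box_poly I (k * d)"
proof (induction k)
  case 0
  then show ?case using box_poly_one[OF assms(1)] by simp
next
  case (Suc k)
  then show ?case using box_poly_mult[OF assms Suc] by simp
qed

lemma box_poly_prod:
  assumes "finite I" "finite A" "\<And>a. a \<in> A \<Longrightarrow> f a \<in> box_poly I d"
  shows "(\<lambda>x. \<Prod>a\<in>A. f a x) \<in> box_poly I (card A * d)"
  using assms(2,3)
proof (induction A rule: finite_induct)
  case empty
  then show ?case using box_poly_one[OF assms(1)] by simp
next
  case (insert a A)
  then show ?case using box_poly_mult[OF assms(1), of "f a" d "\<lambda>x. \<Prod>a\<in>A. f a x"] by simp
qed

lemma poly_funs_box: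
  assumes "finite I" "f \<in> poly_funs I"
  shows "\<exists>d. f \<in> box_poly I d"
  using assms(2)
proof (induction rule: poly_funs.induct)
  case (const c)
  then show ?case using box_poly_scale[OF box_poly_one[OF assms(1)], of c] by auto
next
  case (var i)
  have "monom_fun I (\<lambda>j. if j = i then 1 else 0) = (\<lambda>x. x i)"
  proof
    fix x :: "'a \<Rightarrow> complex"
    have "monom_fun I (\<lambda>j. if j = i then 1 else 0) x = (\<Prod>j\<in>I. if j = i then x i else 1)"
      unfolding monom_fun_def by (rule prod.cong) auto
    then show "monom_fun I (\<lambda>j. if j = i then 1 else 0) x = x i" using var assms(1) by simp
  qed
  moreover have "monom_fun I (\<lambda>j. if j = i then 1 else 0) \<in> box_poly I 1"
    using assms(1) by (intro box_poly_monom) auto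
  ultimately show ?case by metis
next
  case (add f g)
  then obtain d e where "f \<in> box_poly I d" "g \<in> box_poly I e" by blast
  then have "f \<in> box_poly I (max d e)" "g \<in> box_poly I (max d e)"
    using box_poly_mono[OF assms(1)] by (meson max.cobounded1 max.cobounded2)+
  then show ?case using box_poly_add by blast
next
  case (mult f g)
  then show ?case using box_poly_mult[OF assms(1)] by blast
qed

section \<open>The Nullstellensatz over the complex numbers\<close>

definition poly_ideal :: "'v set \<Rightarrow> (('v \<Rightarrow> complex) \<Rightarrow> complex) set \<Rightarrow> bool" where
  "poly_ideal I J \<longleftrightarrow> J \<subseteq> poly_funs I \<and> (\<lambda>x. 0) \<in> J \<and>
     (\<forall>f\<in>J. \<forall>g\<in>J. (\<lambda>x. f x + g x) \<in> J) \<and> (\<forall>f\<in>poly_funs I. \<forall>g\<in>J. (\<lambda>x. f x * g x) \<in> J)"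

lemma poly_idealD:
  assumes "poly_ideal I J"
  shows "f \<in> J \<Longrightarrow> f \<in> poly_funs I" "(\<lambda>x. 0) \<in> J"
    "f \<in> J \<Longrightarrow> g \<in> J \<Longrightarrow> (\<lambda>x. f x + g x) \<in> J"
    "p \<in> poly_funs I \<Longrightarrow> g \<in> J \<Longrightarrow> (\<lambda>x. p x * g x) \<in> J"
  using assms unfolding poly_ideal_def by blast+

lemma poly_ideal_sum:
  assumes "poly_ideal I J"
  shows "finite A \<Longrightarrow> (\<And>a. a \<in> A \<Longrightarrow> f a \<in> J) \<Longrightarrow> (\<lambda>x. \<Sum>a\<in>A. f a x) \<in> J"
  by (induction A rule: finite_induct) (auto intro: poly_idealD[OF assms])

lemma poly_funs_poly:
  assumes "f \<in> poly_funs I"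
  shows "(\<lambda>x. poly q (f x)) \<in> poly_funs I"
proof (induction q)
  case 0
  show ?case by (simp add: poly_funs.const)
next
  case (pCons a q)
  from poly_funs.add[OF poly_funs.const poly_funs.mult[OF assms pCons.IH]] show ?case by simp
qed

text \<open>
  If no \<open>c\<close> worked, then \<open>h\<close> to some power would be a multiple of \<open>x i - c\<close> modulo \<open>J\<close> for
  each of the uncountably many \<open>c\<close>. Infinitely many of these cofactors lie in one
  finite-dimensional space, and a linear relation between them yields a nonzero univariate \<open>q\<close>
  with \<open>h\<^sup>N q(x i)\<close> in \<open>J\<close>. Splitting off the roots of \<open>q\<close> then puts a power of \<open>h\<close> into \<open>J\<close>.
\<close>

lemma nullstellensatz_step:
  assumes I: "finite I" "i \<in> I" and J: "poly_ideal I J"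
    and h: "h \<in> poly_funs I" and pow: "\<And>N. (\<lambda>x. h x ^ N) \<notin> J"
  shows "\<exists>c. \<forall>N. \<forall>g\<in>poly_funs I. (\<lambda>x. h x ^ N - (x i - c) * g x) \<notin> J"
proof (rule ccontr)
  assume "\<not> ?thesis"
  then have "\<exists>N. \<forall>c. \<exists>g\<in>poly_funs I. (\<lambda>x. h x ^ N c - (x i - c) * g x) \<in> J"
    by (intro choice) simp
  then obtain N where "\<forall>c. \<exists>g. g \<in> poly_funs I \<and> (\<lambda>x. h x ^ N c - (x i - c) * g x) \<in> J"
    by (elim exE) (simp add: Bex_def)
  then obtain g where "\<forall>c. g c \<in> poly_funs I \<and> (\<lambda>x. h x ^ N c - (x i - c) * g c x) \<in> J"
    by (rule choice[THEN exE])
  then have g: "\<And>c. g c \<in> poly_funs I"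
    and gJ: "\<And>c. (\<lambda>x. h x ^ N c - (x i - c) * g c x) \<in> J" by simp_all
  have "\<forall>c. \<exists>d. g c \<in> box_poly I d" using g poly_funs_box[OF I(1)] by blast
  then obtain d where d: "\<And>c. g c \<in> box_poly I (d c)" by metis
  have xi: "(\<lambda>x. x i - c) \<in> poly_funs I" for c
    using I(2) by (intro poly_funs_minus poly_funs.var poly_funs.const)

  have "\<exists>y. infinite ((\<lambda>c. (N c, d c)) -` {y})"
  proof (rule ccontr)
    assume "\<nexists>y. infinite ((\<lambda>c. (N c, d c)) -` {y})"
    then have "\<And>y. countable ((\<lambda>c. (N c, d c)) -` {y})" using countable_finite by blast
    then have "countable (\<Union>y. (\<lambda>c. (N c, d c)) -` {y})" by (intro countable_UN) simp_all
    moreover have "(\<Union>y. (\<lambda>c. (N c, d c)) -` {y}) = UNIV" by auto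
    ultimately show False using uncountable_UNIV_complex by simp
  qed
  then obtain N0 d0 where inf: "infinite ((\<lambda>c. (N c, d c)) -` {(N0, d0)})" by fastforce
  obtain A where A: "finite A" "card A = Suc (card (I \<rightarrow>\<^sub>E {..d0}))"
      "A \<subseteq> (\<lambda>c. (N c, d c)) -` {(N0, d0)}"
    using infinite_arbitrarily_large[OF inf] by metis
  have "\<exists>a. (\<exists>c\<in>A. a c \<noteq> 0) \<and> (\<forall>x. (\<Sum>c\<in>A. a c * g c x) = 0)"
  proof (rule lin_span_dependent)
    show "finite (I \<rightarrow>\<^sub>E {..d0})" using I(1) by (rule finite_box)
    show "g c \<in> lin_span (monom_fun I) (I \<rightarrow>\<^sub>E {..d0})" if "c \<in> A" for c
      using d[of c] that A(3) by (auto simp: box_poly_def)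
  qed (use A in auto)
  then obtain a where a: "\<exists>c\<in>A. a c \<noteq> 0" "\<And>x. (\<Sum>c\<in>A. a c * g c x) = 0" by blast

  \<comment> \<open>Modulo \<open>J\<close>, \<open>h x ^ N0\<close> is
    \<open>(x i - c) * g c x\<close> for every \<open>c\<close> in \<open>A\<close>. Multiplied by
    \<open>a c\<close> and by the other linear factors, and summed over \<open>c\<close>, the
    right-hand side becomes the full product of linear factors times the vanishing sum of the
    \<open>a c * g c x\<close>, and the left-hand side becomes
    \<open>h x ^ N0 * poly q (x i)\<close>.\<close>
  define q where "q = (\<Sum>c\<in>A. smult (a c) (\<Prod>c'\<in>A - {c}. [:- c', 1:]))"
  have q_poly: "poly q z = (\<Sum>c\<in>A. a c * (\<Prod>c'\<in>A - {c}. z - c'))" for z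
    by (simp add: q_def poly_sum poly_prod)
  have "q \<noteq> 0"
  proof -
    obtain c0 where c0: "c0 \<in> A" "a c0 \<noteq> 0" using a(1) by blast
    have "(\<Sum>c\<in>A - {c0}. a c * (\<Prod>c'\<in>A - {c}. c0 - c')) = 0"
      using A(1) c0(1) by (intro sum.neutral) auto
    then have "poly q c0 = a c0 * (\<Prod>c'\<in>A - {c0}. c0 - c')"
      unfolding q_poly using A(1) c0(1) by (simp add: sum.remove)
    then have "poly q c0 \<noteq> 0" using c0(2) A(1) by simp
    then show ?thesis by auto
  qed
  have in_J: "(\<lambda>x. h x ^ N0 * poly q (x i)) \<in> J"
  proof -
    have "(\<lambda>x. \<Sum>c\<in>A. (a c * (\<Prod>c'\<in>A - {c}. x i - c')) * (h x ^ N c - (x i - c) * g c x)) \<in> J"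
      using A(1) by (intro poly_ideal_sum[OF J] poly_idealD(4)[OF J] gJ poly_funs.mult
          poly_funs.const poly_funs_prod xi) auto
    moreover have "(\<Sum>c\<in>A. (a c * (\<Prod>c'\<in>A - {c}. x i - c')) * (h x ^ N c - (x i - c) * g c x)) =
        h x ^ N0 * poly q (x i)" for x
    proof -
      have "(a c * (\<Prod>c'\<in>A - {c}. x i - c')) * (h x ^ N c - (x i - c) * g c x) =
          h x ^ N0 * (a c * (\<Prod>c'\<in>A - {c}. x i - c')) - (\<Prod>c'\<in>A. x i - c') * (a c * g c x)"
        if "c \<in> A" for c
      proof -
        have *: "(\<Prod>c'\<in>A. x i - c') = (x i - c) * (\<Prod>c'\<in>A - {c}. x i - c')"
          using A(1) that by (simp add: prod.remove)
        have "N c = N0" using that A(3) by auto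
        then show ?thesis unfolding * by (simp add: algebra_simps)
      qed
      then show ?thesis
        by (simp add: sum_subtractf sum_distrib_left[symmetric] q_poly a(2))
    qed
    ultimately show ?thesis by simp
  qed
  have "(\<lambda>x. h x ^ M * poly r (x i)) \<notin> J" if "r \<noteq> 0" for M r
    using that
  proof (induction "degree r" arbitrary: r M)
    case 0
    then obtain k where k: "r = [:k:]" "k \<noteq> 0" by (metis degree_eq_zeroE pCons_0_0)
    show ?case
    proof
      assume "(\<lambda>x. h x ^ M * poly r (x i)) \<in> J"
      from poly_idealD(4)[OF J poly_funs.const[of "inverse k"] this]
      have "(\<lambda>x. inverse k * (h x ^ M * poly r (x i))) \<in> J" .
      moreover have "(\<lambda>x. inverse k * (h x ^ M * poly r (x i))) = (\<lambda>x. h x ^ M)"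
        using k by (simp add: field_simps)
      ultimately have "(\<lambda>x. h x ^ M) \<in> J" by simp
      then show False using pow by blast
    qed
  next
    case (Suc n)
    have "\<not> constant (poly r)" using Suc.hyps(2) by (simp add: constant_degree)
    then obtain b where "poly r b = 0" using fundamental_theorem_of_algebra by blast
    then obtain s where s: "r = [:- b, 1:] * s" by (metis dvdE poly_eq_0_iff_dvd)
    then have s0: "s \<noteq> 0" using Suc.prems by auto
    have "degree r = Suc (degree s)" unfolding s using s0 by (subst degree_mult_eq) auto
    then have n: "n = degree s" using Suc.hyps(2) by simp
    show ?case
    proof
      assume mem: "(\<lambda>x. h x ^ M * poly r (x i)) \<in> J"
      have hs: "(\<lambda>x. h x ^ M * poly s (x i)) \<in> poly_funs I"
        using h I(2) by (intro poly_funs.mult poly_funs_power poly_funs_poly poly_funs.var)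
      \<comment> \<open>The root \<open>b\<close> of \<open>r\<close> is traded for a power of
        \<open>h\<close>: modulo \<open>J\<close> the factor \<open>x i - b\<close> times
        \<open>g b\<close> is \<open>h ^ N b\<close>, so multiplying by \<open>g b\<close> turns
        \<open>h ^ M * r\<close> into \<open>h ^ (M + N b) * s\<close>.\<close>
      have "(\<lambda>x. g b x * (h x ^ M * poly r (x i)) +
              (h x ^ M * poly s (x i)) * (h x ^ N b - (x i - b) * g b x)) \<in> J"
        by (intro poly_idealD(3)[OF J] poly_idealD(4)[OF J] mem hs gJ g)
      moreover have "(\<lambda>x. g b x * (h x ^ M * poly r (x i)) +
              (h x ^ M * poly s (x i)) * (h x ^ N b - (x i - b) * g b x)) =
            (\<lambda>x. h x ^ (M + N b) * poly s (x i))"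
        unfolding s by (simp add: algebra_simps power_add)
      ultimately show False using Suc.hyps(1)[OF n s0] by simp
    qed
  qed
  then show False using in_J \<open>q \<noteq> 0\<close> by blast
qed

text \<open>The polynomials \<open>x i - c i\<close> can be adjoined for one variable after the
  other while all powers of \<open>h\<close> stay outside the ideal. Modulo the final ideal every
  polynomial \<open>f\<close> is the constant \<open>f c\<close>. A member with \<open>f c\<close>
  nonzero would put \<open>h ^ 0\<close> into the ideal, and \<open>h c = 0\<close> would put
  \<open>h\<close> into it. Carrying \<open>h\<close> along gives the radical form directly, with no
  auxiliary variable.\<close>

theorem nullstellensatz:
  assumes I: "finite I" and J: "poly_ideal I J"
    and h: "h \<in> poly_funs I" and pow: "\<And>N. (\<lambda>x. h x ^ N) \<notin> J"
  shows "\<exists>c. (\<forall>f\<in>J. f c = 0) \<and> h c \<noteq> 0"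
proof -
  have "\<exists>J' c. poly_ideal I J' \<and> J \<subseteq> J' \<and> (\<forall>i\<in>K. (\<lambda>x. x i - c i) \<in> J') \<and> (\<forall>N. (\<lambda>x. h x ^ N) \<notin> J')"
    if "K \<subseteq> I" for K
    using finite_subset[OF that I] that
  proof (induction K rule: finite_induct)
    case empty
    then show ?case using J pow by (intro exI[of _ J]) auto
  next
    case (insert i K)
    then obtain J' c where J': "poly_ideal I J'" "J \<subseteq> J'" "\<forall>i\<in>K. (\<lambda>x. x i - c i) \<in> J'"
      "\<And>N. (\<lambda>x. h x ^ N) \<notin> J'" by auto
    have iI: "i \<in> I" using insert.prems by simp
    obtain ci where ci: "\<And>N g. g \<in> poly_funs I \<Longrightarrow> (\<lambda>x. h x ^ N - (x i - ci) * g x) \<notin> J'"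
      using nullstellensatz_step[OF I iI J'(1) h J'(4)] by blast
    define J'' where "J'' = {f. \<exists>g\<in>poly_funs I. f \<in> poly_funs I \<and> (\<lambda>x. f x - (x i - ci) * g x) \<in> J'}"
    have zero: "(\<lambda>x. 0) \<in> poly_funs I" by (rule poly_funs.const)
    have "poly_ideal I J''"
      unfolding poly_ideal_def
    proof (intro conjI ballI)
      show "J'' \<subseteq> poly_funs I" by (auto simp: J''_def)
      show "(\<lambda>x. 0) \<in> J''" unfolding J''_def
        using poly_idealD(2)[OF J'(1)] zero by (intro CollectI bexI[of _ "\<lambda>x. 0"]) auto
    next
      fix f f' assume "f \<in> J''" "f' \<in> J''"
      then obtain g g' where g: "g \<in> poly_funs I" "f \<in> poly_funs I" "(\<lambda>x. f x - (x i - ci) * g x) \<in> J'"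
        "g' \<in> poly_funs I" "f' \<in> poly_funs I" "(\<lambda>x. f' x - (x i - ci) * g' x) \<in> J'" by (auto simp: J''_def)
      have "(\<lambda>x. (f x + f' x) - (x i - ci) * (g x + g' x)) \<in> J'"
        using poly_idealD(3)[OF J'(1) g(3) g(6)] by (simp add: algebra_simps)
      then show "(\<lambda>x. f x + f' x) \<in> J''" unfolding J''_def using g
        by (intro CollectI bexI[of _ "\<lambda>x. g x + g' x"] conjI poly_funs.add)
    next
      fix p f assume p: "p \<in> poly_funs I" and "f \<in> J''"
      then obtain g where g: "g \<in> poly_funs I" "f \<in> poly_funs I" "(\<lambda>x. f x - (x i - ci) * g x) \<in> J'"
        by (auto simp: J''_def)
      have "(\<lambda>x. (p x * f x) - (x i - ci) * (p x * g x)) \<in> J'"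
        using poly_idealD(4)[OF J'(1) p g(3)] by (simp add: algebra_simps)
      then show "(\<lambda>x. p x * f x) \<in> J''" unfolding J''_def using g p
        by (intro CollectI bexI[of _ "\<lambda>x. p x * g x"] conjI poly_funs.mult)
    qed
    moreover have sub: "J' \<subseteq> J''"
    proof
      fix f assume f: "f \<in> J'"
      then show "f \<in> J''" unfolding J''_def using zero poly_idealD(1)[OF J'(1) f]
        by (intro CollectI bexI[of _ "\<lambda>x. 0"]) auto
    qed
    moreover have "(\<lambda>x. x i - ci) \<in> J''" unfolding J''_def
    proof (intro CollectI bexI[of _ "\<lambda>x. 1"] conjI)
      show "(\<lambda>x. x i - ci) \<in> poly_funs I"
        using iI by (intro poly_funs_minus poly_funs.var poly_funs.const)
    qed (use poly_idealD(2)[OF J'(1)] in \<open>auto intro: poly_funs.const\<close>)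
    moreover have "(\<lambda>x. h x ^ N) \<notin> J''" for N using ci[of _ N] by (auto simp: J''_def)
    ultimately show ?case
      using J'(2,3) insert.hyps(2)
      by (intro exI[of _ J''] exI[of _ "c(i := ci)"]) auto
  qed
  from this[OF order_refl] obtain J' c where J': "poly_ideal I J'" "J \<subseteq> J'"
    "\<And>i. i \<in> I \<Longrightarrow> (\<lambda>x. x i - c i) \<in> J'" "\<And>N. (\<lambda>x. h x ^ N) \<notin> J'" by metis
  have diff: "(\<lambda>x. f x - f c) \<in> J'" if "f \<in> poly_funs I" for f
    using that
  proof (induction rule: poly_funs.induct)
    case (const k)
    then show ?case using poly_idealD(2)[OF J'(1)] by simp
  next
    case (var i)
    then show ?case using J'(3) by simp
  next
    case (add f g)
    from poly_idealD(3)[OF J'(1) add.IH] show ?case by (simp add: algebra_simps)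
  next
    case (mult f g)
    from poly_idealD(3)[OF J'(1) poly_idealD(4)[OF J'(1) mult.hyps(1) mult.IH(2)]
        poly_idealD(4)[OF J'(1) poly_funs.const[of "g c"] mult.IH(1)]]
    show ?case by (simp add: algebra_simps)
  qed
  have vanish: "f c = 0" if "f \<in> J'" for f
  proof (rule ccontr)
    assume nz: "f c \<noteq> 0"
    have "f \<in> poly_funs I" using poly_idealD(1)[OF J'(1) that] .
    from poly_idealD(3)[OF J'(1) that poly_idealD(4)[OF J'(1) poly_funs.const[of "-1"] diff[OF this]]]
    have "(\<lambda>x. f c) \<in> J'" by simp
    from poly_idealD(4)[OF J'(1) poly_funs.const[of "1 / f c"] this] nz
    have "(\<lambda>x. h x ^ 0) \<in> J'" by simp
    then show False using J'(4) by blast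
  qed
  have "h c \<noteq> 0"
  proof
    assume "h c = 0"
    then have "(\<lambda>x. h x ^ 1) \<in> J'" using diff[OF h] by simp
    then show False using J'(4) by blast
  qed
  then show ?thesis using vanish J'(2) by blast
qed

text \<open>The order at the origin is measured on each line through it. This needs no homogeneous
  components, and orders add up in products.\<close>

definition vanishes_to_order :: "nat \<Rightarrow> (('v \<Rightarrow> complex) \<Rightarrow> complex) \<Rightarrow> bool" where
  "vanishes_to_order t f \<longleftrightarrow> (\<forall>x. \<exists>q. \<forall>z. f (\<lambda>i. z * x i) = z ^ t * poly q z)"

lemma vanishes_to_order_add:
  assumes "vanishes_to_order t f" "vanishes_to_order t g"
  shows "vanishes_to_order t (\<lambda>x. f x + g x)"
  unfolding vanishes_to_order_def
proof
  fix x
  obtain p q where "\<forall>z. f (\<lambda>i. z * x i) = z ^ t * poly p z" "\<forall>z. g (\<lambda>i. z * x i) = z ^ t * poly q z"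
    using assms unfolding vanishes_to_order_def by meson
  then show "\<exists>q. \<forall>z. f (\<lambda>i. z * x i) + g (\<lambda>i. z * x i) = z ^ t * poly q z"
    by (intro exI[of _ "p + q"]) (simp add: algebra_simps)
qed

lemma vanishes_to_order_mult:
  assumes "vanishes_to_order s f" "vanishes_to_order t g"
  shows "vanishes_to_order (s + t) (\<lambda>x. f x * g x)"
  unfolding vanishes_to_order_def
proof
  fix x
  obtain p q where "\<forall>z. f (\<lambda>i. z * x i) = z ^ s * poly p z" "\<forall>z. g (\<lambda>i. z * x i) = z ^ t * poly q z"
    using assms unfolding vanishes_to_order_def by meson
  then show "\<exists>q. \<forall>z. f (\<lambda>i. z * x i) * g (\<lambda>i. z * x i) = z ^ (s + t) * poly q z"
    by (intro exI[of _ "p * q"]) (simp add: algebra_simps power_add)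
qed

lemma vanishes_to_order_zero: "vanishes_to_order t (\<lambda>x. 0)"
  unfolding vanishes_to_order_def by (auto intro: exI[of _ 0])

lemma vanishes_to_order_sum:
  "finite A \<Longrightarrow> (\<And>a. a \<in> A \<Longrightarrow> vanishes_to_order t (f a)) \<Longrightarrow> vanishes_to_order t (\<lambda>x. \<Sum>a\<in>A. f a x)"
  by (induction A rule: finite_induct) (auto intro: vanishes_to_order_zero vanishes_to_order_add)

lemma vanishes_to_order_0:
  assumes "f \<in> poly_funs I"
  shows "vanishes_to_order 0 f"
  using assms
proof (induction rule: poly_funs.induct)
  case (const c)
  show ?case unfolding vanishes_to_order_def by (auto intro: exI[of _ "[:c:]"])
next
  case (var i)
  show ?case unfolding vanishes_to_order_def
  proof
    fix x :: "'a \<Rightarrow> complex"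
    show "\<exists>q. \<forall>z. z * x i = z ^ 0 * poly q z" by (intro exI[of _ "[:0, x i:]"]) simp
  qed
next
  case (mult f g)
  then show ?case using vanishes_to_order_mult[of 0 f 0 g] by simp
qed (rule vanishes_to_order_add)

lemma vanishes_to_order_scale: "vanishes_to_order t f \<Longrightarrow> vanishes_to_order t (\<lambda>x. c * f x)"
  using vanishes_to_order_mult[OF vanishes_to_order_0[OF poly_funs.const[of c]]] by simp

lemma vanishes_to_order_1:
  assumes "f \<in> poly_funs I" "f (\<lambda>_. 0) = 0"
  shows "vanishes_to_order 1 f"
  unfolding vanishes_to_order_def
proof
  fix x
  obtain q where q: "\<And>z. f (\<lambda>i. z * x i) = poly q z"
    using vanishes_to_order_0[OF assms(1)] unfolding vanishes_to_order_def by fastforce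
  have "poly q 0 = 0" using q[of 0] assms(2) by simp
  then obtain r where "q = pCons 0 r" by (cases q) auto
  then show "\<exists>q. \<forall>z. f (\<lambda>i. z * x i) = z ^ 1 * poly q z" using q by auto
qed

lemma monom_fun_scale: "monom_fun I \<beta> (\<lambda>i. z * x i) = z ^ (\<Sum>i\<in>I. \<beta> i) * monom_fun I \<beta> x"
  by (simp add: monom_fun_def power_mult_distrib prod.distrib power_sum)

text \<open>
  By the Nullstellensatz the ideal \<open>J\<close> of the \<open>F l\<close> contains powers of all variables, so modulo
  the order-\<open>t\<close> jets every polynomial is a combination of boundedly many monomials times
  monomials of degree \<open>O(t)\<close> in the \<open>F l\<close>. Comparing the growth rates \<open>t^card I\<close> and
  \<open>t^card K\<close> gives the bound.
\<close>

theorem card_vars_le_card_equations: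
  fixes F :: "'l \<Rightarrow> ('v \<Rightarrow> complex) \<Rightarrow> complex"
  assumes I: "finite I" and K: "finite K"
    and F: "\<And>l. l \<in> K \<Longrightarrow> F l \<in> poly_funs I"
    and F0: "\<And>l. l \<in> K \<Longrightarrow> F l (\<lambda>_. 0) = 0"
    and unique: "\<And>x i. (\<And>l. l \<in> K \<Longrightarrow> F l x = 0) \<Longrightarrow> i \<in> I \<Longrightarrow> x i = 0"
  shows "card I \<le> card K"
proof (rule ccontr)
  assume "\<not> card I \<le> card K"
  then have lt: "card K < card I" by simp
  define J where "J = {f. \<exists>g. (\<forall>l\<in>K. g l \<in> poly_funs I) \<and> f = (\<lambda>x. \<Sum>l\<in>K. g l x * F l x)}"
  have JI: "(\<lambda>x. \<Sum>l\<in>K. g l x * F l x) \<in> J" if "\<And>l. l \<in> K \<Longrightarrow> g l \<in> poly_funs I" for g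
    unfolding J_def using that by blast
  have J: "poly_ideal I J"
    unfolding poly_ideal_def
  proof (intro conjI ballI)
    show "J \<subseteq> poly_funs I"
      by (auto simp: J_def intro!: poly_funs_sum K poly_funs.mult F)
    show "(\<lambda>x. 0) \<in> J" using JI[of "\<lambda>l x. 0"] by (simp add: poly_funs.const)
  next
    fix f f' assume "f \<in> J" "f' \<in> J"
    then obtain g g' where g: "\<forall>l\<in>K. g l \<in> poly_funs I" "f = (\<lambda>x. \<Sum>l\<in>K. g l x * F l x)"
      "\<forall>l\<in>K. g' l \<in> poly_funs I" "f' = (\<lambda>x. \<Sum>l\<in>K. g' l x * F l x)" by (auto simp: J_def)
    show "(\<lambda>x. f x + f' x) \<in> J"
      using JI[of "\<lambda>l x. g l x + g' l x"] g by (simp add: poly_funs.add algebra_simps sum.distrib)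
  next
    fix p f assume "p \<in> poly_funs I" "f \<in> J"
    then obtain g where g: "\<forall>l\<in>K. g l \<in> poly_funs I" "f = (\<lambda>x. \<Sum>l\<in>K. g l x * F l x)"
      by (auto simp: J_def)
    show "(\<lambda>x. p x * f x) \<in> J"
      using JI[of "\<lambda>l x. p x * g l x"] g \<open>p \<in> poly_funs I\<close>
      by (simp add: poly_funs.mult algebra_simps sum_distrib_left)
  qed
  have FJ: "F l \<in> J" if "l \<in> K" for l
  proof -
    have "(\<lambda>x. \<Sum>l'\<in>K. (if l' = l then 1 else 0) * F l' x) \<in> J"
      by (rule JI) (auto intro: poly_funs.const)
    moreover have "(\<Sum>l'\<in>K. (if l' = l then 1 else 0) * F l' x) = F l x" for x
      using K that sum.delta[of K l "\<lambda>l. F l x"]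
      by (simp only: if_distrib[of "\<lambda>z. z * _"] mult_1_left mult_zero_left) simp
    ultimately show ?thesis by simp
  qed

  have "\<exists>N. (\<lambda>x. x i ^ N) \<in> J" if "i \<in> I" for i
  proof (rule ccontr)
    assume "\<nexists>N. (\<lambda>x. x i ^ N) \<in> J"
    then obtain c where "\<forall>f\<in>J. f c = 0" "c i \<noteq> 0"
      using nullstellensatz[OF I J poly_funs.var[OF \<open>i \<in> I\<close>]] by blast
    then show False using unique[of c i] FJ that by blast
  qed
  then obtain N0 where N0: "\<And>i. i \<in> I \<Longrightarrow> (\<lambda>x. x i ^ N0 i) \<in> J" by metis
  define N where "N = (\<Sum>i\<in>I. N0 i)"
  have N: "(\<lambda>x. x i ^ k) \<in> J" if "i \<in> I" "N \<le> k" for i k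
  proof -
    have "N0 i \<le> N" unfolding N_def using I that by (intro member_le_sum) auto
    then have "(\<lambda>x :: 'v \<Rightarrow> complex. x i ^ k) = (\<lambda>x. x i ^ (k - N0 i) * x i ^ N0 i)"
      using that by (simp add: power_add[symmetric])
    then show ?thesis using poly_idealD(4)[OF J poly_funs_power[OF poly_funs.var] N0] that by simp
  qed

  \<comment> \<open>A monomial with some exponent above \<open>N\<close> is a multiple of a power
    that lies in \<open>J\<close>; only the monomials of the box survive.\<close>
  have box_J: "\<exists>s\<in>box_poly I N. \<exists>j\<in>J. f = (\<lambda>x. s x + j x)" if "f \<in> poly_funs I" for f
  proof -
    have mon: "\<exists>s\<in>box_poly I N. \<exists>j\<in>J. monom_fun I \<beta> = (\<lambda>x. s x + j x)" for \<beta>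
    proof (cases "\<forall>i\<in>I. \<beta> i \<le> N")
      case True
      then have "monom_fun I \<beta> \<in> box_poly I N" using I by (intro box_poly_monom) auto
      then show ?thesis using poly_idealD(2)[OF J] by (intro bexI[of _ "monom_fun I \<beta>"] bexI[of _ "\<lambda>x. 0"]) auto
    next
      case False
      then obtain i where i: "i \<in> I" "N \<le> \<beta> i" by auto
      have "monom_fun I \<beta> = (\<lambda>x. monom_fun (I - {i}) \<beta> x * x i ^ \<beta> i)"
        using monom_fun_upd[OF I i(1)] by (simp add: fun_eq_iff mult.commute)
      moreover have "monom_fun (I - {i}) \<beta> \<in> poly_funs I"
        unfolding monom_fun_def using I by (intro poly_funs_prod poly_funs_power poly_funs.var) auto
      ultimately have "monom_fun I \<beta> \<in> J" using poly_idealD(4)[OF J _ N[OF i]] by simp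
      moreover have "(\<lambda>x. 0) \<in> box_poly I N" unfolding box_poly_def by (rule lin_span_zero)
      ultimately show ?thesis by (intro bexI[of _ "\<lambda>x. 0"] bexI[of _ "monom_fun I \<beta>"]) auto
    qed
    obtain d where "f \<in> box_poly I d" using poly_funs_box[OF I \<open>f \<in> poly_funs I\<close>] by blast
    then obtain c where c: "f = (\<lambda>x. \<Sum>\<beta>\<in>I \<rightarrow>\<^sub>E {..d}. c \<beta> * monom_fun I \<beta> x)" by (rule box_polyE)
    obtain s j where sj: "\<And>\<beta>. s \<beta> \<in> box_poly I N" "\<And>\<beta>. j \<beta> \<in> J"
      "\<And>\<beta>. monom_fun I \<beta> = (\<lambda>x. s \<beta> x + j \<beta> x)" using mon by metis
    show ?thesis
    proof (intro bexI)
      show "f = (\<lambda>x. (\<Sum>\<beta>\<in>I \<rightarrow>\<^sub>E {..d}. c \<beta> * s \<beta> x) + (\<Sum>\<beta>\<in>I \<rightarrow>\<^sub>E {..d}. c \<beta> * j \<beta> x))"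
        unfolding c sj(3) by (simp add: algebra_simps sum.distrib)
      show "(\<lambda>x. \<Sum>\<beta>\<in>I \<rightarrow>\<^sub>E {..d}. c \<beta> * s \<beta> x) \<in> box_poly I N"
        by (intro box_poly_sum finite_box I box_poly_scale sj)
      show "(\<lambda>x. \<Sum>\<beta>\<in>I \<rightarrow>\<^sub>E {..d}. c \<beta> * j \<beta> x) \<in> J"
        by (intro poly_ideal_sum[OF J] finite_box I poly_idealD(4)[OF J] poly_funs.const sj)
    qed
  qed

  \<comment> \<open>The products of a monomial in the variables, with exponents at most
    \<open>N\<close>, and a monomial in the \<open>F l\<close>, with exponents at most
    \<open>t\<close>. Only the second factor grows with \<open>t\<close>.\<close>
  define gen where "gen = (\<lambda>(e, \<alpha>) x. monom_fun I e x * monom_fun K \<alpha> (\<lambda>l. F l x))"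
  define idx where "idx t = (I \<rightarrow>\<^sub>E {..N}) \<times> (K \<rightarrow>\<^sub>E {..t::nat})" for t
  have fin_idx: "finite (idx t)" for t unfolding idx_def using I K by (simp add: finite_box)
  have gen_in: "(\<lambda>x. monom_fun I e x * monom_fun K \<alpha> (\<lambda>l. F l x)) \<in> lin_span gen (idx t)"
    if "e \<in> I \<rightarrow>\<^sub>E {..N}" "\<forall>l\<in>K. \<alpha> l \<le> t" for e \<alpha> t
  proof -
    have "(e, restrict \<alpha> K) \<in> idx t" using that by (auto simp: idx_def)
    from lin_span_base[OF fin_idx this, of gen]
    show ?thesis using monom_fun_cong[of K "restrict \<alpha> K" \<alpha>] by (simp add: gen_def)
  qed
  have span_E: "\<exists>c. u = (\<lambda>x. \<Sum>(e, \<alpha>)\<in>idx t. c (e, \<alpha>) * (monom_fun I e x * monom_fun K \<alpha> (\<lambda>l. F l x)))"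
    if "u \<in> lin_span gen (idx t)" for u t
    using that by (auto simp: lin_span_def gen_def case_prod_unfold)
  have span_mult: "(\<lambda>x. u x * F l x) \<in> lin_span gen (idx (Suc t))" if u: "u \<in> lin_span gen (idx t)" and l: "l \<in> K" for u l t
  proof -
    obtain c where c: "u = (\<lambda>x. \<Sum>(e, \<alpha>)\<in>idx t. c (e, \<alpha>) * (monom_fun I e x * monom_fun K \<alpha> (\<lambda>l. F l x)))"
      using span_E[OF u] by blast
    have up: "monom_fun K \<alpha> (\<lambda>l. F l x) * F l x = monom_fun K (\<alpha>(l := Suc (\<alpha> l))) (\<lambda>l. F l x)" for \<alpha> x
    proof -
      have "monom_fun (K - {l}) (\<alpha>(l := Suc (\<alpha> l))) = monom_fun (K - {l}) \<alpha>"
        by (rule monom_fun_cong) auto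
      then show ?thesis
        unfolding monom_fun_upd[OF K l] by simp
    qed
    have "(\<lambda>x. u x * F l x) = (\<lambda>x. \<Sum>y\<in>idx t. c y *
       (monom_fun I (fst y) x * monom_fun K ((snd y)(l := Suc (snd y l))) (\<lambda>l. F l x)))"
      unfolding c by (simp add: sum_distrib_right case_prod_unfold up mult.assoc)
    also have "\<dots> \<in> lin_span gen (idx (Suc t))"
    proof (intro lin_span_sum fin_idx lin_span_scale gen_in)
      fix y assume "y \<in> idx t"
      then show "fst y \<in> I \<rightarrow>\<^sub>E {..N}" "\<forall>l'\<in>K. ((snd y)(l := Suc (snd y l))) l' \<le> Suc t"
        using l by (auto simp: idx_def PiE_def Pi_def intro: le_SucI)
    qed
    finally show ?thesis .
  qed
  have span_box: "s \<in> lin_span gen (idx t)" if "s \<in> box_poly I N" for s t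
  proof -
    obtain c where c: "s = (\<lambda>x. \<Sum>\<beta>\<in>I \<rightarrow>\<^sub>E {..N}. c \<beta> * monom_fun I \<beta> x)"
      using \<open>s \<in> box_poly I N\<close> by (rule box_polyE)
    have "monom_fun I \<beta> \<in> lin_span gen (idx t)" if "\<beta> \<in> I \<rightarrow>\<^sub>E {..N}" for \<beta>
      using gen_in[OF that, of "\<lambda>_. 0" t] by (simp add: monom_fun_def[of K])
    then show ?thesis unfolding c by (intro lin_span_sum finite_box I lin_span_scale)
  qed

  \<comment> \<open>Write \<open>f\<close> as a box polynomial plus the sum of the
    \<open>g l * F l\<close> and approximate the \<open>g l\<close>. As \<open>F l\<close> vanishes
    at the origin, each round gains one order and raises the exponents of the \<open>F l\<close> by
    at most one.\<close>
  have approx: "\<exists>u\<in>lin_span gen (idx t). vanishes_to_order t (\<lambda>x. f x - u x)" if "f \<in> poly_funs I" for f t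
    using that
  proof (induction t arbitrary: f)
    case 0
    then show ?case using vanishes_to_order_0 by (intro bexI[of _ "\<lambda>x. 0"] lin_span_zero) simp
  next
    case (Suc t)
    obtain s j where sj: "s \<in> box_poly I N" "j \<in> J" "f = (\<lambda>x. s x + j x)" using box_J[OF Suc.prems] by blast
    obtain g where g: "\<And>l. l \<in> K \<Longrightarrow> g l \<in> poly_funs I" "j = (\<lambda>x. \<Sum>l\<in>K. g l x * F l x)"
      using sj(2) by (auto simp: J_def)
    have "\<forall>l. \<exists>u. l \<in> K \<longrightarrow> u \<in> lin_span gen (idx t) \<and> vanishes_to_order t (\<lambda>x. g l x - u x)"
      using Suc.IH g(1) by blast
    then obtain u where u: "\<And>l. l \<in> K \<Longrightarrow> u l \<in> lin_span gen (idx t)"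
      "\<And>l. l \<in> K \<Longrightarrow> vanishes_to_order t (\<lambda>x. g l x - u l x)" by metis
    show ?case
    proof (intro bexI)
      show "(\<lambda>x. s x + (\<Sum>l\<in>K. u l x * F l x)) \<in> lin_span gen (idx (Suc t))"
        by (intro lin_span_add span_box sj lin_span_sum K span_mult u)
      have "vanishes_to_order (Suc t) (\<lambda>x. (g l x - u l x) * F l x)" if "l \<in> K" for l
        using vanishes_to_order_mult[OF u(2) vanishes_to_order_1[OF F F0]] that by simp
      then have "vanishes_to_order (Suc t) (\<lambda>x. \<Sum>l\<in>K. (g l x - u l x) * F l x)"
        by (intro vanishes_to_order_sum K)
      then show "vanishes_to_order (Suc t) (\<lambda>x. f x - (s x + (\<Sum>l\<in>K. u l x * F l x)))"
        unfolding sj(3) g(2) by (simp add: algebra_simps sum_subtractf)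
    qed
  qed

  define m k where "m = card I" and "k = card K"
  \<comment> \<open>\<open>C\<close> is chosen such that the bound for \<open>card (idx t)\<close>
    becomes \<open>C * Suc C ^ k\<close>, which is below \<open>Suc C ^ Suc k\<close>. The order
    \<open>t\<close> exceeds the total degree \<open>m * C\<close> of every monomial in the box of
    size \<open>C\<close>, so a combination of these that vanishes to order \<open>t\<close> is
    zero.\<close>
  define C where "C = Suc N ^ m * (m + 2) ^ k"
  define t where "t = m * C + 1"
  have "card (idx t) = Suc N ^ m * (m * C + 2) ^ k"
    unfolding idx_def m_def k_def t_def by (simp add: card_cartesian_product card_box I K)
  also have "\<dots> \<le> Suc N ^ m * ((m + 2) * Suc C) ^ k"
    by (intro mult_left_mono power_mono) auto
  also have "\<dots> = C * Suc C ^ k" 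
    by (simp only: power_mult_distrib mult.assoc[symmetric] C_def[symmetric])
  also have "\<dots> < Suc C ^ Suc k" by simp
  also have "\<dots> \<le> Suc C ^ m" using lt unfolding m_def k_def by (intro power_increasing) auto
  also have "\<dots> = card (I \<rightarrow>\<^sub>E {..C})" by (simp add: card_box I m_def)
  finally have card: "card (idx t) < card (I \<rightarrow>\<^sub>E {..C})" .
  have "\<forall>\<beta>. \<exists>u. u \<in> lin_span gen (idx t) \<and> vanishes_to_order t (\<lambda>x. monom_fun I \<beta> x - u x)"
    using approx[OF monom_fun_poly[OF I]] by blast
  then obtain u where "\<forall>\<beta>. u \<beta> \<in> lin_span gen (idx t) \<and> vanishes_to_order t (\<lambda>x. monom_fun I \<beta> x - u \<beta> x)"
    by (rule choice[THEN exE])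
  then have u: "\<And>\<beta>. u \<beta> \<in> lin_span gen (idx t)"
    "\<And>\<beta>. vanishes_to_order t (\<lambda>x. monom_fun I \<beta> x - u \<beta> x)" by simp_all
  from lin_span_dependent[OF fin_idx finite_box[OF I] card u(1)]
  obtain a where "(\<exists>\<beta>\<in>I \<rightarrow>\<^sub>E {..C}. a \<beta> \<noteq> 0) \<and> (\<forall>x. (\<Sum>\<beta>\<in>I \<rightarrow>\<^sub>E {..C}. a \<beta> * u \<beta> x) = 0)"
    by (rule exE)
  then have a: "\<exists>\<beta>\<in>I \<rightarrow>\<^sub>E {..C}. a \<beta> \<noteq> 0" "\<And>x. (\<Sum>\<beta>\<in>I \<rightarrow>\<^sub>E {..C}. a \<beta> * u \<beta> x) = 0"
    by simp_all
  have "vanishes_to_order t (\<lambda>x. \<Sum>\<beta>\<in>I \<rightarrow>\<^sub>E {..C}. a \<beta> * (monom_fun I \<beta> x - u \<beta> x))"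
    by (rule vanishes_to_order_sum[OF finite_box[OF I]]) (rule vanishes_to_order_scale[OF u(2)])
  then have van: "vanishes_to_order t (\<lambda>x. \<Sum>\<beta>\<in>I \<rightarrow>\<^sub>E {..C}. a \<beta> * monom_fun I \<beta> x)"
    by (simp add: right_diff_distrib sum_subtractf a(2))
  have "(\<Sum>\<beta>\<in>I \<rightarrow>\<^sub>E {..C}. a \<beta> * monom_fun I \<beta> x) = 0" for x
  proof -
    obtain q where q: "\<And>z. (\<Sum>\<beta>\<in>I \<rightarrow>\<^sub>E {..C}. a \<beta> * monom_fun I \<beta> (\<lambda>i. z * x i)) = z ^ t * poly q z"
      using van unfolding vanishes_to_order_def by blast
    define p where "p = (\<Sum>\<beta>\<in>I \<rightarrow>\<^sub>E {..C}. monom (a \<beta> * monom_fun I \<beta> x) (\<Sum>i\<in>I. \<beta> i))"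
    have "poly p z = poly (monom 1 t * q) z" for z
      using q[of z] by (simp add: p_def poly_sum poly_monom monom_fun_scale algebra_simps)
    then have pq: "p = monom 1 t * q" by (simp add: poly_eq_poly_eq_iff[symmetric] fun_eq_iff)
    have "degree p \<le> m * C"
      unfolding p_def
    proof (intro degree_sum_le finite_box I)
      fix \<beta> assume "\<beta> \<in> I \<rightarrow>\<^sub>E {..C}"
      then have "(\<Sum>i\<in>I. \<beta> i) \<le> (\<Sum>i\<in>I. C)" by (intro sum_mono) auto
      then show "degree (monom (a \<beta> * monom_fun I \<beta> x) (\<Sum>i\<in>I. \<beta> i)) \<le> m * C"
        using degree_monom_le[of "a \<beta> * monom_fun I \<beta> x" "\<Sum>i\<in>I. \<beta> i"] by (simp add: m_def)
    qed
    moreover have "degree p \<ge> t" if "q \<noteq> 0"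
      using that unfolding pq by (subst degree_mult_eq) (auto simp: degree_monom_eq)
    ultimately have "p = 0" unfolding t_def pq by (cases "q = 0") auto
    then have "poly p 1 = 0" by simp
    then show ?thesis by (simp add: p_def poly_sum poly_monom)
  qed
  then have "\<forall>\<beta>\<in>I \<rightarrow>\<^sub>E {..C}. a \<beta> = 0"
    by (intro monom_fun_independent[OF I finite_box[OF I] inj_on_restrict_PiE])
  then show False using a(1) by blast
qed

text \<open>There are \<open>Suc s ^ card T\<close> products of the \<open>f i\<close> with
  exponents up to \<open>s\<close>, while all of them lie in a box of size linear in
  \<open>s\<close> in only \<open>card I\<close> variables. For large \<open>s\<close> there are
  more products than the dimension allows.\<close>

lemma algebraically_dependent:
  assumes I: "finite I" and T: "finite T" and f: "\<And>i. i \<in> T \<Longrightarrow> f i \<in> poly_funs I"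
    and card: "card I < card T"
  shows "\<exists>s c. (\<exists>\<beta>\<in>T \<rightarrow>\<^sub>E {..s}. c \<beta> \<noteq> 0) \<and>
           (\<forall>x. (\<Sum>\<beta>\<in>T \<rightarrow>\<^sub>E {..s}. c \<beta> * monom_fun T \<beta> (\<lambda>i. f i x)) = 0)"
proof -
  have "\<forall>i. \<exists>d. i \<in> T \<longrightarrow> f i \<in> box_poly I d" using f poly_funs_box[OF I] by blast
  then obtain d where d: "\<And>i. i \<in> T \<Longrightarrow> f i \<in> box_poly I (d i)" by metis
  define D where "D = (\<Sum>i\<in>T. d i)"
  have D: "f i \<in> box_poly I D" if "i \<in> T" for i
  proof (rule box_poly_mono[OF I _ d[OF that]])
    show "d i \<le> D" unfolding D_def using that T by (intro member_le_sum) auto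
  qed
  \<comment> \<open>With this \<open>s\<close> the box dimension is at most
    \<open>s * Suc s ^ m\<close>, hence below \<open>Suc s ^ Suc m\<close>.\<close>
  define m \<tau> s where "m = card I" and "\<tau> = card T" and "s = (\<tau> * D + 1) ^ m"
  have mem: "(\<lambda>x. monom_fun T \<beta> (\<lambda>i. f i x)) \<in> box_poly I (\<tau> * (s * D))" if "\<beta> \<in> T \<rightarrow>\<^sub>E {..s}" for \<beta>
    unfolding monom_fun_def \<tau>_def
  proof (intro box_poly_prod I T)
    fix i assume i: "i \<in> T"
    then have "\<beta> i \<le> s" using that by auto
    then show "(\<lambda>x. f i x ^ \<beta> i) \<in> box_poly I (s * D)"
      by (intro box_poly_mono[OF I _ box_poly_power[OF I D[OF i]]] mult_right_mono) auto
  qed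
  have "card (I \<rightarrow>\<^sub>E {..\<tau> * (s * D)}) = (\<tau> * D * s + 1) ^ m"
    by (simp add: card_box I m_def algebra_simps)
  also have "\<dots> \<le> ((\<tau> * D + 1) * Suc s) ^ m" by (intro power_mono) auto
  also have "\<dots> = s * Suc s ^ m" by (simp only: power_mult_distrib s_def[symmetric])
  also have "\<dots> < Suc s ^ Suc m" by simp
  also have "\<dots> \<le> Suc s ^ \<tau>" using card unfolding m_def \<tau>_def by (intro power_increasing) auto
  also have "\<dots> = card (T \<rightarrow>\<^sub>E {..s})" by (simp add: card_box T \<tau>_def)
  finally have "card (I \<rightarrow>\<^sub>E {..\<tau> * (s * D)}) < card (T \<rightarrow>\<^sub>E {..s})" .
  from lin_span_dependent[OF finite_box[OF I] finite_box[OF T] this, of "\<lambda>\<beta> x. monom_fun T \<beta> (\<lambda>i. f i x)" "monom_fun I"]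
  show ?thesis using mem unfolding box_poly_def by blast
qed

section \<open>One-parameter families\<close>

lemma univariate_poly:
  assumes "f \<in> poly_funs I"
  shows "\<exists>q. \<forall>t. f (\<lambda>_. t) = poly q t"
  using assms
proof (induction rule: poly_funs.induct)
  case (const c)
  show ?case by (intro exI[of _ "[:c:]"]) simp
next
  case (var i)
  show ?case by (intro exI[of _ "[:0, 1:]"]) simp
next
  case (add f g)
  then obtain p q where "\<forall>t. f (\<lambda>_. t) = poly p t" "\<forall>t. g (\<lambda>_. t) = poly q t" by blast
  then show ?case by (intro exI[of _ "p + q"]) simp
next
  case (mult f g)
  then obtain p q where "\<forall>t. f (\<lambda>_. t) = poly p t" "\<forall>t. g (\<lambda>_. t) = poly q t" by blast
  then show ?case by (intro exI[of _ "p * q"]) simp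
qed

lemma poly_funs_finite_zeros:
  assumes "f \<in> poly_funs I" "f (\<lambda>_. t0) \<noteq> 0"
  shows "finite {t. f (\<lambda>_. t) = 0}"
proof -
  obtain q where q: "\<And>t. f (\<lambda>_. t) = poly q t" using univariate_poly[OF assms(1)] by blast
  then have "q \<noteq> 0" using assms(2) by auto
  then show ?thesis using poly_roots_finite by (simp add: q)
qed

text \<open>The density argument for families over the single variable \<open>()\<close>: an
  identity that holds for generic parameters extends to the exceptional ones, where the matrices
  involved may be singular.\<close>

lemma poly_funs_eq_off_finite:
  assumes "f \<in> poly_funs I" "g \<in> poly_funs I" "finite E" "\<And>t. t \<notin> E \<Longrightarrow> f (\<lambda>_. t) = g (\<lambda>_. t)"
  shows "f (\<lambda>_. t) = g (\<lambda>_. t)"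
proof -
  obtain p where p: "\<And>t. f (\<lambda>_. t) = poly p t" using univariate_poly[OF assms(1)] by blast
  obtain q where q: "\<And>t. g (\<lambda>_. t) = poly q t" using univariate_poly[OF assms(2)] by blast
  have "p = q" using assms(4) unfolding p q by (rule poly_eq_if_eq_infinite[OF assms(3)])
  then show ?thesis by (simp add: p q)
qed

section \<open>Matrices of polynomial functions\<close>

lemma det_poly_funs:
  assumes "\<And>i j. (\<lambda>x. M x $ i $ j) \<in> poly_funs I"
  shows "(\<lambda>x. det (M x)) \<in> poly_funs I"
  unfolding det_def
  by (intro poly_funs_sum poly_funs.mult poly_funs.const poly_funs_prod finite_permutations finite assms)

lemma matrix_vector_mult_poly_funs:
  assumes "\<And>i j. (\<lambda>x. M x $ i $ j) \<in> poly_funs I" "\<And>j. (\<lambda>x. v x $ j) \<in> poly_funs I"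
  shows "(\<lambda>x. (M x *v v x) $ i) \<in> poly_funs I"
  unfolding matrix_vector_mult_def using assms by (simp add: poly_funs_sum poly_funs.mult)

lemma mat_poly_funs:
  assumes "f \<in> poly_funs I"
  shows "(\<lambda>x. mat (f x) $ i $ j) \<in> poly_funs I"
  using assms by (cases "i = j") (simp_all add: mat_def poly_funs.const)

lemma polynomial_functions_comp:
  assumes "f \<in> polynomial_functions" "\<And>k i j. (\<lambda>u. \<Phi> u $ k $ i $ j) \<in> poly_funs I"
  shows "(\<lambda>u. f (\<Phi> u)) \<in> poly_funs I"
  using assms(1) by induction (auto intro: poly_funs.intros assms(2))

section \<open>Kernels, inverses and eigenvectors\<close>

lemma det_eq_0_kernel:
  fixes M :: "'a::field^'n^'n"
  shows "det M = 0 \<longleftrightarrow> (\<exists>v. v \<noteq> 0 \<and> M *v v = 0)"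
  using invertible_det_nz[of M] matrix_left_invertible_ker[of M] invertible_left_inverse[of M] by auto

lemma matrix_inv_inverse:
  fixes g :: "'a::semiring_1^'n^'n"
  assumes "invertible g"
  shows "g ** matrix_inv g = mat 1" "matrix_inv g ** g = mat 1"
  using someI_ex[OF assms[unfolded invertible_def]] by (simp_all add: matrix_inv_def)

lemma matrix_inv_matrix_inv:
  fixes g :: "'a::semiring_1^'n^'n"
  assumes "invertible g"
  shows "invertible (matrix_inv g)" "matrix_inv (matrix_inv g) = g"
proof -
  show inv: "invertible (matrix_inv g)"
    unfolding invertible_def using matrix_inv_inverse[OF assms] by blast
  have "matrix_inv (matrix_inv g) = (g ** matrix_inv g) ** matrix_inv (matrix_inv g)"
    by (simp add: matrix_inv_inverse[OF assms])
  also have "\<dots> = g" by (simp add: matrix_mul_assoc[symmetric] matrix_inv_inverse[OF inv])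
  finally show "matrix_inv (matrix_inv g) = g" .
qed

lemma invariants_conj_inv:
  assumes "f \<in> invariants" "invertible g"
  shows "f (\<chi> k. matrix_inv g ** (A $ k) ** g) = f A"
  using assms matrix_inv_matrix_inv[OF assms(2)]
  unfolding invariants_def general_linear_group_def conj_action_def by auto

lemma matrix_vector_mult_axis: "(M *v axis j 1) $ i = (M :: 'a::semiring_1^'n^'m) $ i $ j"
  by (simp add: matrix_vector_mult_def axis_def if_distrib cong: if_cong)

text \<open>If \<open>det (B - mat t)\<close> were constant in \<open>t\<close>, then
  \<open>det (t B - 1)\<close>, which for nonzero \<open>t\<close> is \<open>t ^ p\<close> times the
  value at \<open>1 / t\<close>, would be a constant times \<open>t ^ p\<close> and vanish at
  \<open>t = 0\<close>, where it is \<open>det (- mat 1)\<close>. So it has a root, and the root is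
  an eigenvalue.\<close>

lemma complex_eigenvector:
  fixes B :: "complex^'p^'p"
  shows "\<exists>z v. v \<noteq> 0 \<and> B *v v = z *s v"
proof -
  have "(\<lambda>x. det (B - mat (x ()))) \<in> poly_funs {()}"
    by (intro det_poly_funs, unfold vector_minus_component)
       (intro poly_funs_minus mat_poly_funs poly_funs.var poly_funs.const, simp)
  then obtain q where q: "\<And>t. det (B - mat t) = poly q t" using univariate_poly by fastforce
  have r: "(\<lambda>x. det ((\<chi> i. x () *s B $ i) - mat 1)) \<in> poly_funs {()}"
    by (intro det_poly_funs, unfold vector_minus_component vec_lambda_beta vector_smult_component)
       (intro poly_funs_minus mat_poly_funs poly_funs.mult poly_funs.var poly_funs.const, simp)
  have "\<not> constant (poly q)"
  proof
    assume "constant (poly q)"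
    then have c: "\<And>t. det (B - mat t) = poly q 0" unfolding q constant_def by blast
    have "(\<lambda>x. x () ^ CARD('p) * poly q 0) \<in> poly_funs {()}"
      by (intro poly_funs.intros poly_funs_power) auto
    from poly_funs_eq_off_finite[OF r this, of "{0}" 0]
    have "det ((\<chi> i. 0 *s B $ i) - mat 1) = 0 ^ CARD('p) * poly q 0"
    proof
      fix t :: complex assume "t \<notin> {0}"
      then have "(\<chi> i. t *s B $ i) - mat 1 = (\<chi> i. t *s (B - mat (1 / t)) $ i)"
        by (auto simp: vec_eq_iff mat_def field_simps)
      then have "det ((\<chi> i. t *s B $ i) - mat 1) = t ^ CARD('p) * det (\<chi> i. (B - mat (1 / t)) $ i)"
        using det_rows_mul[of "\<lambda>_. t" "\<lambda>i. (B - mat (1 / t)) $ i"] by (simp only: prod_constant)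
      then show "det ((\<chi> i. t *s B $ i) - mat 1) = t ^ CARD('p) * poly q 0"
        using c by (simp only: vec_nth_inverse)
    qed auto
    moreover have "(\<chi> i. 0 *s B $ i) - mat 1 = - mat 1" by (simp add: vec_eq_iff)
    ultimately have "det (- mat 1 :: complex^'p^'p) = 0" by simp
    moreover have "- mat 1 = (\<chi> i. (-1) *s (mat 1 :: complex^'p^'p) $ i)" by (simp add: vec_eq_iff)
    ultimately show False
      using det_rows_mul[of "\<lambda>_. -1" "\<lambda>i. (mat 1 :: complex^'p^'p) $ i"] by simp
  qed
  then obtain z where "poly q z = 0" using fundamental_theorem_of_algebra by blast
  then obtain v where v: "v \<noteq> 0" "(B - mat z) *v v = 0" using q det_eq_0_kernel by metis
  have "mat z *v v = z *s v"
    by (simp add: vec_eq_iff matrix_vector_mult_def mat_def if_distrib[of "\<lambda>a. a * _"] cong: if_cong)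
  then have "B *v v = z *s v" using v(2) by (simp add: matrix_vector_mult_diff_rdistrib)
  then show ?thesis using v(1) by blast
qed

lemma invertible_with_column:
  fixes v :: "'a::field^'p" and e0 :: 'p
  assumes "v \<noteq> 0"
  shows "\<exists>g. invertible g \<and> g *v axis e0 1 = v"
proof -
  obtain i0 where i0: "v $ i0 \<noteq> 0" using assms by (auto simp: vec_eq_iff)
  \<comment> \<open>The identity matrix with column \<open>e0\<close> replaced by \<open>v\<close>;
    if \<open>i0\<close> differs from \<open>e0\<close>, the unit vector displaced by
    \<open>v\<close> takes the place of column \<open>i0\<close>.\<close>
  define g :: "'a^'p^'p" where
    "g = (\<chi> i j. if j = e0 then v $ i else if j = i0 then (if i = e0 then 1 else 0) else if i = j then 1 else 0)"
  have "x = 0" if "g *v x = 0" for x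
  proof -
    have row: "(\<Sum>j\<in>UNIV. g $ i $ j * x $ j) = 0" for i
      using that by (simp add: vec_eq_iff matrix_vector_mult_def)
    have "(\<Sum>j\<in>UNIV. g $ i0 $ j * x $ j) = (\<Sum>j\<in>UNIV. if j = e0 then v $ i0 * x $ j else 0)"
      by (intro sum.cong) (auto simp: g_def)
    then have e0: "x $ e0 = 0" using row[of i0] i0 by simp
    have "x $ j = 0" if "j \<noteq> e0" for j
    proof -
      define i where "i = (if j = i0 then e0 else j)"
      have "(\<Sum>j'\<in>UNIV. g $ i $ j' * x $ j') = (\<Sum>j'\<in>UNIV. if j' = j then x $ j' else 0)"
        using that e0 by (intro sum.cong) (auto simp: g_def i_def)
      then show ?thesis using row[of i] by simp
    qed
    then have "x $ j = 0" for j using e0 by (cases "j = e0") auto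
    then show ?thesis by (simp add: vec_eq_iff)
  qed
  then have "invertible g" using matrix_left_invertible_ker[of g] invertible_left_inverse[of g] by blast
  moreover have "g *v axis e0 1 = v" by (simp add: vec_eq_iff matrix_vector_mult_axis g_def)
  ultimately show ?thesis by blast
qed

section \<open>The Krull dimension of the invariant ring\<close>

lemma invariants_const: "(\<lambda>A. c) \<in> invariants"
  by (simp add: invariants_def polynomial_functions.const)

lemma invariants_add: "f \<in> invariants \<Longrightarrow> h \<in> invariants \<Longrightarrow> (\<lambda>A. f A + h A) \<in> invariants"
  by (simp add: invariants_def polynomial_functions.add)

lemma invariants_mult: "f \<in> invariants \<Longrightarrow> h \<in> invariants \<Longrightarrow> (\<lambda>A. f A * h A) \<in> invariants"
  by (simp add: invariants_def polynomial_functions.mult)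

lemma invariants_sum:
  "finite B \<Longrightarrow> (\<And>b. b \<in> B \<Longrightarrow> f b \<in> invariants) \<Longrightarrow> (\<lambda>A. \<Sum>b\<in>B. f b A) \<in> invariants"
  by (induction B rule: finite_induct) (auto intro: invariants_const invariants_add)

lemma invariants_power: "f \<in> invariants \<Longrightarrow> (\<lambda>A. f A ^ k) \<in> invariants"
  by (induction k) (auto intro: invariants_const invariants_mult)

lemma invariants_monom:
  assumes "finite T" "\<And>i. i \<in> T \<Longrightarrow> f i \<in> invariants"
  shows "(\<lambda>A. monom_fun T \<beta> (\<lambda>i. f i A)) \<in> invariants"
  unfolding monom_fun_def using assms
proof (induction T rule: finite_induct)
  case empty
  show ?case by (simp add: invariants_const)
next
  case (insert i T)
  then show ?case by (simp add: invariants_mult[OF invariants_power])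
qed

lemma invariant_ring_simps:
  "carrier invariant_ring = invariants"
  "f \<otimes>\<^bsub>invariant_ring\<^esub> h = (\<lambda>A. f A * h A)"
  "f \<oplus>\<^bsub>invariant_ring\<^esub> h = (\<lambda>A. f A + h A)"
  "\<one>\<^bsub>invariant_ring\<^esub> = (\<lambda>A. 1)" "\<zero>\<^bsub>invariant_ring\<^esub> = (\<lambda>A. 0)"
  by (simp_all add: invariant_ring_def)

lemma primeideal_invariant_ring:
  assumes "primeideal Q invariant_ring"
  shows "f \<in> Q \<Longrightarrow> f \<in> invariants" "(\<lambda>A. 0) \<in> Q"
    "f \<in> Q \<Longrightarrow> h \<in> Q \<Longrightarrow> (\<lambda>A. f A + h A) \<in> Q"
    "f \<in> invariants \<Longrightarrow> h \<in> Q \<Longrightarrow> (\<lambda>A. f A * h A) \<in> Q"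
    "(\<lambda>A. 1) \<notin> Q"
    "f \<in> invariants \<Longrightarrow> h \<in> invariants \<Longrightarrow> (\<lambda>A. f A * h A) \<in> Q \<Longrightarrow> f \<in> Q \<or> h \<in> Q"
proof -
  interpret primeideal Q invariant_ring by (rule assms)
  show "f \<in> Q \<Longrightarrow> f \<in> invariants" using Icarr[of f] by (simp add: invariant_ring_simps)
  show "(\<lambda>A. 0) \<in> Q" using additive_subgroup.zero_closed[OF is_additive_subgroup] by (simp add: invariant_ring_simps)
  show "f \<in> Q \<Longrightarrow> h \<in> Q \<Longrightarrow> (\<lambda>A. f A + h A) \<in> Q"
    using additive_subgroup.a_closed[OF is_additive_subgroup, of f h] by (simp add: invariant_ring_simps)
  show "f \<in> invariants \<Longrightarrow> h \<in> Q \<Longrightarrow> (\<lambda>A. f A * h A) \<in> Q"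
    using I_l_closed[of h f] by (simp add: invariant_ring_simps)
  show "(\<lambda>A. 1) \<notin> Q"
    using one_imp_carrier I_notcarr by (auto simp: invariant_ring_simps)
  show "f \<in> invariants \<Longrightarrow> h \<in> invariants \<Longrightarrow> (\<lambda>A. f A * h A) \<in> Q \<Longrightarrow> f \<in> Q \<or> h \<in> Q"
    using I_prime[of f h] by (simp add: invariant_ring_simps)
qed

lemma primeideal_sum:
  assumes "primeideal Q invariant_ring"
  shows "finite B \<Longrightarrow> (\<And>b. b \<in> B \<Longrightarrow> f b \<in> Q) \<Longrightarrow> (\<lambda>A. \<Sum>b\<in>B. f b A) \<in> Q"
  by (induction B rule: finite_induct) (auto intro: primeideal_invariant_ring[OF assms])

lemma primeideal_power:
  assumes Q: "primeideal Q invariant_ring" and f: "f \<in> invariants" "f \<notin> Q"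
  shows "(\<lambda>A. f A ^ k) \<notin> Q"
proof (induction k)
  case 0
  then show ?case using primeideal_invariant_ring(5)[OF Q] by simp
next
  case (Suc k)
  then show ?case
    using primeideal_invariant_ring(6)[OF Q f(1) invariants_power[OF f(1)]] f(2) by auto
qed

text \<open>
  Elements \<open>x i \<in> P (i + 1) - P i\<close> along a chain of primes are algebraically independent: dividing
  out the lowest power of \<open>x j\<close> from a polynomial relation modulo \<open>P j\<close> and then reducing modulo
  \<open>P (j + 1)\<close> eliminates \<open>x j\<close>.
\<close>

lemma prime_chain_independent:
  fixes P :: "nat \<Rightarrow> (('p::finite, 'n::finite) mat_tuple \<Rightarrow> complex) set"
  assumes P: "\<And>i. i \<le> d \<Longrightarrow> primeideal (P i) invariant_ring"
    and x: "\<And>i. i < d \<Longrightarrow> x i \<in> P (Suc i)" "\<And>i. i < d \<Longrightarrow> x i \<notin> P i"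
    and sub: "\<And>i. i < d \<Longrightarrow> P i \<subseteq> P (Suc i)"
    and "j \<le> d" "finite B" "B \<noteq> {}" "inj_on (\<lambda>\<beta>. restrict \<beta> {j..<d}) B" "\<And>\<beta>. \<beta> \<in> B \<Longrightarrow> c \<beta> \<noteq> 0"
  shows "(\<lambda>A. \<Sum>\<beta>\<in>B. c \<beta> * monom_fun {j..<d} \<beta> (\<lambda>i. x i A)) \<notin> P j"
  using assms(5-9)
proof (induction "d - j" arbitrary: j B)
  case 0
  then have j: "j = d" by simp
  obtain \<beta> where b: "\<beta> \<in> B" using 0 by blast
  have "B = {\<beta>}" using 0 b by (auto simp: j inj_on_def)
  then have eq: "(\<lambda>A. \<Sum>\<beta>\<in>B. c \<beta> * monom_fun {j..<d} \<beta> (\<lambda>i. x i A)) = (\<lambda>A. c \<beta>)"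
    by (simp add: j monom_fun_def)
  show ?case unfolding eq
  proof
    assume "(\<lambda>A. c \<beta>) \<in> P j"
    from primeideal_invariant_ring(4)[OF P[OF 0(2)] invariants_const[of "1 / c \<beta>"] this]
    show False using 0(6)[OF b] primeideal_invariant_ring(5)[OF P[OF 0(2)]] by simp
  qed
next
  case (Suc m)
  have jd: "j < d" "Suc j \<le> d" "m = d - Suc j" using Suc.hyps(2) by simp_all
  have xinv: "x i \<in> invariants" if "i < d" for i
    using primeideal_invariant_ring(1)[OF P x(1)] that by simp
  note Pj = P[OF Suc.prems(1)] and Pj' = P[OF jd(2)]
  define e where "e = Min ((\<lambda>\<beta>. \<beta> j) ` B)"
  have e_le: "e \<le> \<beta> j" if "\<beta> \<in> B" for \<beta> unfolding e_def using that Suc.prems(2) by simp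
  define B' where "B' = {\<beta> \<in> B. \<beta> j = e}"
  have B': "finite B'" "B' \<subseteq> B" using Suc.prems(2) by (auto simp: B'_def)
  have "e \<in> (\<lambda>\<beta>. \<beta> j) ` B" unfolding e_def using Suc.prems(2,3) by (intro Min_in) auto
  then have B'ne: "B' \<noteq> {}" by (auto simp: B'_def)
  let ?m = "\<lambda>\<beta> A. monom_fun {Suc j..<d} \<beta> (\<lambda>i. x i A)"
  define g where "g = (\<lambda>A. \<Sum>\<beta>\<in>B. (c \<beta> * x j A ^ (\<beta> j - e)) * ?m \<beta> A)"
  have split: "monom_fun {j..<d} \<beta> (\<lambda>i. x i A) = x j A ^ \<beta> j * ?m \<beta> A" for \<beta> A
  proof -
    have "{j..<d} - {j} = {Suc j..<d}" using jd by auto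
    then show ?thesis using monom_fun_upd[of "{j..<d}" j] jd by simp
  qed
  have factor: "(\<lambda>A. \<Sum>\<beta>\<in>B. c \<beta> * monom_fun {j..<d} \<beta> (\<lambda>i. x i A)) = (\<lambda>A. x j A ^ e * g A)"
  proof
    fix A
    have "c \<beta> * monom_fun {j..<d} \<beta> (\<lambda>i. x i A) = x j A ^ e * ((c \<beta> * x j A ^ (\<beta> j - e)) * ?m \<beta> A)"
      if "\<beta> \<in> B" for \<beta>
    proof -
      have "x j A ^ \<beta> j = x j A ^ e * x j A ^ (\<beta> j - e)" using e_le[OF that] by (simp add: power_add[symmetric])
      then show ?thesis unfolding split by simp
    qed
    then show "(\<Sum>\<beta>\<in>B. c \<beta> * monom_fun {j..<d} \<beta> (\<lambda>i. x i A)) = x j A ^ e * g A"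
      unfolding g_def sum_distrib_left by (rule sum.cong[OF refl])
  qed
  have minv: "?m \<beta> \<in> invariants" for \<beta> by (intro invariants_monom xinv) auto
  have ginv: "g \<in> invariants" unfolding g_def
    by (intro invariants_sum Suc.prems(2) invariants_mult invariants_const invariants_power xinv minv jd)
  show ?case unfolding factor
  proof
    assume "(\<lambda>A. x j A ^ e * g A) \<in> P j"
    then have "g \<in> P j"
      using primeideal_invariant_ring(6)[OF Pj invariants_power[OF xinv[OF jd(1)]] ginv]
        primeideal_power[OF Pj xinv[OF jd(1)] x(2)[OF jd(1)]] by blast
    then have g: "g \<in> P (Suc j)" using sub[OF jd(1)] by blast
    define h where "h = (\<lambda>A. \<Sum>\<beta>\<in>B - B'. (c \<beta> * x j A ^ (\<beta> j - e)) * ?m \<beta> A)"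
    have h: "h \<in> P (Suc j)"
      unfolding h_def
    proof (rule primeideal_sum[OF Pj'])
      fix \<beta> assume b: "\<beta> \<in> B - B'"
      then have "e \<noteq> \<beta> j" "e \<le> \<beta> j" using e_le by (auto simp: B'_def)
      then obtain r where r: "\<beta> j - e = Suc r" by (metis Suc_diff_Suc le_neq_implies_less)
      have "(\<lambda>A. ((c \<beta> * x j A ^ r) * ?m \<beta> A) * x j A) \<in> P (Suc j)"
        by (intro primeideal_invariant_ring(4)[OF Pj'] invariants_mult invariants_const
            invariants_power xinv minv jd x)
      then show "(\<lambda>A. (c \<beta> * x j A ^ (\<beta> j - e)) * ?m \<beta> A) \<in> P (Suc j)"
        unfolding r by (simp add: mult_ac)
    qed (use Suc.prems(2) in auto)
    have "(\<lambda>A. g A + (-1) * h A) \<in> P (Suc j)"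
      by (intro primeideal_invariant_ring(3)[OF Pj' g] primeideal_invariant_ring(4)[OF Pj' _ h]
          invariants_const)
    moreover have "g A + (-1) * h A = (\<Sum>\<beta>\<in>B'. c \<beta> * ?m \<beta> A)" for A
    proof -
      have "g A = h A + (\<Sum>\<beta>\<in>B'. (c \<beta> * x j A ^ (\<beta> j - e)) * ?m \<beta> A)"
        unfolding g_def h_def by (rule sum.subset_diff[OF B'(2) Suc.prems(2)])
      then show ?thesis by (simp add: B'_def)
    qed
    ultimately have "(\<lambda>A. \<Sum>\<beta>\<in>B'. c \<beta> * ?m \<beta> A) \<in> P (Suc j)" by simp
    moreover have "(\<lambda>A. \<Sum>\<beta>\<in>B'. c \<beta> * ?m \<beta> A) \<notin> P (Suc j)"
    proof (rule Suc.hyps(1)[OF jd(3) jd(2) B'(1) B'ne])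
      show "inj_on (\<lambda>\<beta>. restrict \<beta> {Suc j..<d}) B'"
      proof (rule inj_onI)
        fix \<beta> \<gamma> assume bg: "\<beta> \<in> B'" "\<gamma> \<in> B'" "restrict \<beta> {Suc j..<d} = restrict \<gamma> {Suc j..<d}"
        have "restrict \<beta> {j..<d} i = restrict \<gamma> {j..<d} i" for i
          using fun_cong[OF bg(3), of i] bg(1,2) by (cases "i = j") (auto simp: B'_def restrict_def)
        then have "restrict \<beta> {j..<d} = restrict \<gamma> {j..<d}" by blast
        then show "\<beta> = \<gamma>"
          by (rule inj_onD[OF Suc.prems(4)]) (use bg B'(2) in auto)
      qed
      show "c \<beta> \<noteq> 0" if "\<beta> \<in> B'" for \<beta> using that B'(2) Suc.prems(5) by blast
    qed
    ultimately show False by blast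
  qed
qed

text \<open>A chain of length \<open>k\<close> yields \<open>k\<close> independent invariants. If
  \<open>k\<close> exceeds \<open>card I\<close>, their restrictions along \<open>\<Phi>\<close>
  satisfy a polynomial relation, and by \<open>determined\<close> this relation holds on all tuples,
  against independence modulo \<open>P 0\<close>.\<close>

lemma krull_dim_invariant_ring_le:
  fixes \<Phi> :: "('v \<Rightarrow> complex) \<Rightarrow> ('p::finite, 'n::finite) mat_tuple"
  assumes I: "finite I" and \<Phi>: "\<And>k i j. (\<lambda>u. \<Phi> u $ k $ i $ j) \<in> poly_funs I"
    and determined: "\<And>f A. f \<in> invariants \<Longrightarrow> (\<And>u. f (\<Phi> u) = 0) \<Longrightarrow> f A = 0"
  shows "krull_dim (invariant_ring :: (('p, 'n) mat_tuple \<Rightarrow> complex) ring) \<le> enat (card I)"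
  unfolding krull_dim_def
proof (rule Sup_least)
  fix z assume "z \<in> {enat k |k. \<exists>P :: nat \<Rightarrow> (('p, 'n) mat_tuple \<Rightarrow> complex) set.
    (\<forall>i\<le>k. primeideal (P i) invariant_ring) \<and> (\<forall>i<k. P i \<subset> P (Suc i))}"
  then obtain k and P :: "nat \<Rightarrow> (('p, 'n) mat_tuple \<Rightarrow> complex) set" where z: "z = enat k"
    and P: "\<And>i. i \<le> k \<Longrightarrow> primeideal (P i) invariant_ring" "\<And>i. i < k \<Longrightarrow> P i \<subset> P (Suc i)" by blast
  have "k \<le> card I"
  proof (rule ccontr)
    assume k: "\<not> k \<le> card I"
    have "\<forall>i. \<exists>x. i < k \<longrightarrow> x \<in> P (Suc i) \<and> x \<notin> P i" using P(2) by blast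
    then obtain x where x: "\<And>i. i < k \<Longrightarrow> x i \<in> P (Suc i)" "\<And>i. i < k \<Longrightarrow> x i \<notin> P i" by metis
    have xinv: "x i \<in> invariants" if "i < k" for i
      using primeideal_invariant_ring(1)[OF P(1) x(1)] that by simp
    have "\<exists>s c. (\<exists>\<beta>\<in>{0..<k} \<rightarrow>\<^sub>E {..s}. c \<beta> \<noteq> 0) \<and>
           (\<forall>u. (\<Sum>\<beta>\<in>{0..<k} \<rightarrow>\<^sub>E {..s}. c \<beta> * monom_fun {0..<k} \<beta> (\<lambda>i. x i (\<Phi> u))) = 0)"
    proof (rule algebraically_dependent[OF I])
      show "(\<lambda>u. x i (\<Phi> u)) \<in> poly_funs I" if "i \<in> {0..<k}" for i
        using xinv[of i] that by (intro polynomial_functions_comp[OF _ \<Phi>]) (simp add: invariants_def)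
    qed (use k in auto)
    then obtain s c where c: "\<exists>\<beta>\<in>{0..<k} \<rightarrow>\<^sub>E {..s}. c \<beta> \<noteq> 0"
      "\<And>u. (\<Sum>\<beta>\<in>{0..<k} \<rightarrow>\<^sub>E {..s}. c \<beta> * monom_fun {0..<k} \<beta> (\<lambda>i. x i (\<Phi> u))) = 0"
      by (elim exE conjE, intro that) (assumption, erule spec)
    have fin: "finite ({0..<k} \<rightarrow>\<^sub>E {..s})" by (simp add: finite_box)
    let ?f = "\<lambda>A. \<Sum>\<beta>\<in>{0..<k} \<rightarrow>\<^sub>E {..s}. c \<beta> * monom_fun {0..<k} \<beta> (\<lambda>i. x i A)"
    have "?f \<in> invariants"
      by (intro invariants_sum fin invariants_mult invariants_const invariants_monom xinv) auto
    then have f0: "?f A = 0" for A by (rule determined[of ?f, OF _ c(2)])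
    define B where "B = {\<beta> \<in> {0..<k} \<rightarrow>\<^sub>E {..s}. c \<beta> \<noteq> 0}"
    have "(\<lambda>A. \<Sum>\<beta>\<in>B. c \<beta> * monom_fun {0..<k} \<beta> (\<lambda>i. x i A)) \<notin> P 0"
    proof (rule prime_chain_independent[of k P x, OF P(1) x])
      show "inj_on (\<lambda>\<beta>. restrict \<beta> {0..<k}) B"
        by (rule inj_on_subset[OF inj_on_restrict_PiE]) (auto simp: B_def)
    qed (use P(2) c(1) fin in \<open>auto simp: B_def\<close>)
    moreover have "(\<Sum>\<beta>\<in>B. c \<beta> * monom_fun {0..<k} \<beta> (\<lambda>i. x i A)) = ?f A" for A
      by (rule sum.mono_neutral_left[OF fin]) (auto simp: B_def)
    ultimately have "(\<lambda>A. 0) \<notin> P 0" using f0 by simp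
    then show False using primeideal_invariant_ring(2)[OF P(1)] by simp
  qed
  then show "z \<le> enat (card I)" by (simp add: z)
qed

text \<open>
  Generically, an eigenvector \<open>v\<close> of \<open>A $ k2\<close> is cyclic for \<open>A $ k1\<close>. In the basis \<open>v\<close>, \<open>A $ k1 v\<close>,
  \<open>(A $ k1)\<^sup>2 v\<close>, \<dots> the matrix \<open>A $ k1\<close> is a companion matrix and the first column of \<open>A $ k2\<close> is
  a multiple of the first unit vector, so an invariant is determined by its restriction to the
  tuples of this shape.
\<close>

lemma invariant_determined_by_cyclic_form:
  fixes f :: "('p::finite, 'n::finite) mat_tuple \<Rightarrow> complex" and e :: "nat \<Rightarrow> 'p"
  assumes f: "f \<in> invariants" and k: "k1 \<noteq> k2" and e: "bij_betw e {0..<CARD('p)} UNIV"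
    and vanish: "\<And>A. (\<And>r i. Suc r < CARD('p) \<Longrightarrow> A $ k1 $ i $ e r = (if i = e (Suc r) then 1 else 0)) \<Longrightarrow>
      (\<And>i. i \<noteq> e 0 \<Longrightarrow> A $ k2 $ i $ e 0 = 0) \<Longrightarrow> f A = 0"
  shows "f A = 0"
proof -
  define ix where "ix = inv_into {0..<CARD('p)} e"
  have ix_e: "ix (e r) = r" if "r < CARD('p)" for r
    unfolding ix_def using e that by (intro inv_into_f_f) (auto simp: bij_betw_def)
  have e_ix: "e (ix i) = i" "ix i < CARD('p)" for i
  proof -
    have "i \<in> e ` {0..<CARD('p)}" using e by (simp add: bij_betw_def)
    then show "e (ix i) = i" "ix i < CARD('p)" unfolding ix_def
      using f_inv_into_f[of i e "{0..<CARD('p)}"] inv_into_into[of i e "{0..<CARD('p)}"] by auto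
  qed
  have ix0: "ix (e 0) = 0" by (intro ix_e) simp
  define S :: "complex^'p^'p" where "S = (\<chi> i j. if Suc (ix j) < CARD('p) \<and> i = e (Suc (ix j)) then 1 else 0)"

  have triangular: "f A = 0" if A: "\<And>i. i \<noteq> e 0 \<Longrightarrow> A $ k2 $ i $ e 0 = 0" for A :: "('p, 'n) mat_tuple"
  proof -
    \<comment> \<open>A path from \<open>A $ k1\<close> at \<open>t = 0\<close> to the shift matrix
      \<open>S\<close> at \<open>t = 1\<close>, where the Krylov matrix \<open>K\<close> is the
      identity. Hence \<open>K t\<close> is invertible for all but finitely many \<open>t\<close>.
      The \<open>k2\<close>-th matrix is not moved, so the first unit vector remains its
      eigenvector.\<close>
    define B where "B t = (\<chi> i j. (1 - t) * A $ k1 $ i $ j + t * S $ i $ j)" for t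
    define \<Gamma> where "\<Gamma> t = (\<chi> k. if k = k1 then B t else A $ k)" for t
    define w where "w t r = ((\<lambda>v. B t *v v) ^^ r) (axis (e 0) 1)" for t r
    define K where "K t = (\<chi> i j. w t (ix j) $ i)" for t
    have B_poly: "(\<lambda>x. B (x ()) $ i $ j) \<in> poly_funs {()}" for i j
      unfolding B_def by (simp, intro poly_funs.add poly_funs.mult poly_funs_minus poly_funs.const poly_funs.var) auto
    have w_poly: "(\<lambda>x. w (x ()) r $ i) \<in> poly_funs {()}" for r i
    proof (induction r arbitrary: i)
      case 0
      show ?case unfolding w_def by (simp add: poly_funs.const)
    next
      case (Suc r)
      show ?case using matrix_vector_mult_poly_funs[OF B_poly Suc] by (simp add: w_def)
    qed
    have det_poly: "(\<lambda>x. det (K (x ()))) \<in> poly_funs {()}"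
      by (rule det_poly_funs) (simp add: K_def w_poly)
    have \<Gamma>_poly: "(\<lambda>x. \<Gamma> (x ()) $ k $ i $ j) \<in> poly_funs {()}" for k i j
      unfolding \<Gamma>_def using B_poly by (cases "k = k1") (simp_all add: poly_funs.const)
    have f\<Gamma>_poly: "(\<lambda>x. f (\<Gamma> (x ()))) \<in> poly_funs {()}"
      using f by (intro polynomial_functions_comp[OF _ \<Gamma>_poly]) (simp add: invariants_def)

    have "w 1 r = axis (e r) 1" if "r < CARD('p)" for r
      using that
    proof (induction r)
      case 0
      show ?case by (simp add: w_def)
    next
      case (Suc r)
      have "w 1 (Suc r) = S *v axis (e r) 1"
        using Suc by (simp add: w_def) (simp add: B_def vec_lambda_eta)
      moreover have "S *v axis (e r) 1 = axis (e (Suc r)) 1"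
        unfolding vec_eq_iff matrix_vector_mult_axis
        using Suc.prems by (simp add: S_def ix_e axis_def)
      ultimately show ?case by simp
    qed
    then have "K 1 = mat 1" by (simp add: K_def e_ix vec_eq_iff axis_def mat_def)
    then have fin: "finite {t. det (K t) = 0}"
      using poly_funs_finite_zeros[OF det_poly, of 1] by simp
    have "f (\<Gamma> t) = 0" if "t \<notin> {t. det (K t) = 0}" for t
    proof -
      have inv: "invertible (K t)" using that by (simp add: invertible_det_nz)
      have col: "K t *v axis (e r) 1 = w t r" if "r < CARD('p)" for r
        by (simp add: vec_eq_iff matrix_vector_mult_axis K_def ix_e that)
      have col': "matrix_inv (K t) *v w t r = axis (e r) 1" if "r < CARD('p)" for r
        by (simp add: col[OF that, symmetric] matrix_vector_mul_assoc matrix_inv_inverse[OF inv])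
      define A' where "A' = (\<chi> k. matrix_inv (K t) ** (\<Gamma> t $ k) ** K t)"
      have A'_entry: "A' $ k $ i $ e r = (matrix_inv (K t) *v (\<Gamma> t $ k *v w t r)) $ i" if "r < CARD('p)" for k i r
        by (simp add: A'_def matrix_vector_mult_axis[symmetric] col[OF that, symmetric] matrix_vector_mul_assoc matrix_mul_assoc)
      have "f A' = 0"
      proof (rule vanish)
        fix r i assume r: "Suc r < CARD('p)"
        then have "A' $ k1 $ i $ e r = (matrix_inv (K t) *v w t (Suc r)) $ i"
          by (simp add: A'_entry \<Gamma>_def w_def)
        then show "A' $ k1 $ i $ e r = (if i = e (Suc r) then 1 else 0)"
          by (simp add: col'[OF r] axis_def)
      next
        fix i assume i: "i \<noteq> e 0"
        have "A $ k2 *v axis (e 0) 1 = (A $ k2 $ e 0 $ e 0) *s axis (e 0) 1"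
          unfolding vec_eq_iff matrix_vector_mult_axis using A by (auto simp: axis_def)
        then have "\<Gamma> t $ k2 *v w t 0 = (A $ k2 $ e 0 $ e 0) *s w t 0"
          using k by (simp add: \<Gamma>_def w_def)
        then have "A' $ k2 $ i $ e 0 = ((A $ k2 $ e 0 $ e 0) *s (matrix_inv (K t) *v w t 0)) $ i"
          by (simp add: A'_entry vec.scale)
        then show "A' $ k2 $ i $ e 0 = 0" using i by (simp add: col' axis_def)
      qed
      then show ?thesis using invariants_conj_inv[OF f inv] by (simp add: A'_def)
    qed
    from poly_funs_eq_off_finite[OF f\<Gamma>_poly poly_funs.const[of 0] fin this, of 0]
    have "f (\<Gamma> 0) = 0" by simp
    moreover have "\<Gamma> 0 = A" by (simp add: \<Gamma>_def B_def vec_eq_iff)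
    ultimately show ?thesis by simp
  qed

  obtain z v where v: "v \<noteq> 0" "A $ k2 *v v = z *s v" using complex_eigenvector by blast
  obtain g where g: "invertible g" "g *v axis (e 0) 1 = v" using invertible_with_column[OF v(1)] by blast
  have gv: "matrix_inv g *v v = axis (e 0) 1"
    unfolding g(2)[symmetric] by (simp add: matrix_vector_mul_assoc matrix_inv_inverse[OF g(1)])
  have "f (\<chi> k. matrix_inv g ** (A $ k) ** g) = 0"
  proof (rule triangular)
    fix i assume "i \<noteq> e 0"
    have "(matrix_inv g ** (A $ k2) ** g) *v axis (e 0) 1 = matrix_inv g *v (A $ k2 *v (g *v axis (e 0) 1))"
      by (simp add: matrix_vector_mul_assoc matrix_mul_assoc)
    also have "\<dots> = z *s axis (e 0) 1" by (simp add: g v gv vec.scale)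
    finally show "(\<chi> k. matrix_inv g ** (A $ k) ** g) $ k2 $ i $ e 0 = 0"
      using \<open>i \<noteq> e 0\<close> by (simp add: matrix_vector_mult_axis[symmetric]) (simp add: axis_def)
  qed
  then show "f A = 0" using invariants_conj_inv[OF f g(1)] by simp
qed

theorem krull_dim_invariant_ring:
  assumes "CARD('n::finite) \<ge> 2"
  shows "krull_dim (invariant_ring :: (('p::finite, 'n) mat_tuple \<Rightarrow> complex) ring)
    \<le> enat ((CARD('n) - 1) * CARD('p)\<^sup>2 + 1)"
proof -
  let ?p = "CARD('p)" and ?n = "CARD('n)"
  obtain k1 k2 :: 'n where k: "k1 \<noteq> k2"
    using assms by (metis card_2_iff' ex_card UNIV_I)
  obtain e :: "nat \<Rightarrow> 'p" where e: "bij_betw e {0..<?p} UNIV"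
    using ex_bij_betw_nat_finite[of "UNIV :: 'p set"] by auto
  define l where "l = e (?p - 1)"
  \<comment> \<open>The prescribed entries: all columns but the last, in the order \<open>e\<close>,
    of the \<open>k1\<close>-th matrix, and the first column of the \<open>k2\<close>-th matrix
    outside the diagonal. Their number \<open>p (p - 1) + (p - 1) = p^2 - 1\<close> is the dimension
    of the projective linear group, which acts on the tuples.\<close>
  define X where "X = {k1} \<times> (UNIV \<times> (UNIV - {l}) :: ('p \<times> 'p) set) \<union> {k2} \<times> ((UNIV - {e 0}) \<times> {e 0})"
  define I where "I = UNIV - X"
  define \<Phi> where "\<Phi> u = (\<chi> k i j. if (k, i, j) \<in> I then u (k, i, j)
      else if k = k1 \<and> (\<exists>r. Suc r < ?p \<and> j = e r \<and> i = e (Suc r)) then 1 else (0 :: complex))" for u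
  have "card X = ?p * (?p - 1) + (?p - 1)"
    unfolding X_def using k by (subst card_Un_disjoint) (auto simp: card_cartesian_product)
  then have "card I = ?n * (?p * ?p) - (?p * (?p - 1) + (?p - 1))"
    unfolding I_def by (simp add: card_Diff_subset card_prod)
  moreover have "?p * (?p - 1) + (?p - 1) + 1 = ?p * ?p"
    using zero_less_card_finite[where 'a = 'p] by (cases ?p) auto
  moreover have "?n * (?p * ?p) = (?n - 1) * (?p * ?p) + ?p * ?p"
    using assms by (cases ?n) auto
  ultimately have card: "card I = (?n - 1) * ?p\<^sup>2 + 1" by (simp add: power2_eq_square)
  have inj: "r = s" if "e r = e s" "r < ?p" "s < ?p" for r s
    using e that by (auto simp: bij_betw_def inj_on_def)
  show ?thesis unfolding card[symmetric]
  proof (rule krull_dim_invariant_ring_le)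
    show "finite I" by simp
    show "(\<lambda>u. \<Phi> u $ k $ i $ j) \<in> poly_funs I" for k i j
      by (cases "(k, i, j) \<in> I") (simp_all add: \<Phi>_def poly_funs.const poly_funs.var)
    fix f :: "('p, 'n) mat_tuple \<Rightarrow> complex" and A
    assume f: "f \<in> invariants" and f0: "\<And>u. f (\<Phi> u) = 0"
    show "f A = 0"
    proof (rule invariant_determined_by_cyclic_form[OF f k e])
      fix A :: "('p, 'n) mat_tuple"
      assume A1: "\<And>r i. Suc r < ?p \<Longrightarrow> A $ k1 $ i $ e r = (if i = e (Suc r) then 1 else 0)"
        and A2: "\<And>i. i \<noteq> e 0 \<Longrightarrow> A $ k2 $ i $ e 0 = 0"
      have "\<Phi> (\<lambda>(k, i, j). A $ k $ i $ j) $ k $ i $ j = A $ k $ i $ j" for k i j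
      proof (cases "(k, i, j) \<in> I")
        case True
        then show ?thesis by (simp add: \<Phi>_def)
      next
        case False
        then consider "k = k1" "j \<noteq> l" | "k = k2" "i \<noteq> e 0" "j = e 0" by (auto simp: I_def X_def)
        then show ?thesis
        proof cases
          case 1
          have "j \<in> e ` {0..<?p}" using e by (simp add: bij_betw_def)
          then obtain r where r: "r < ?p" "j = e r" by auto
          have "r \<noteq> ?p - 1" using 1(2) r(2) by (auto simp: l_def)
          then have r': "Suc r < ?p" using r(1) by linarith
          have "(\<exists>s. Suc s < ?p \<and> j = e s \<and> i = e (Suc s)) \<longleftrightarrow> i = e (Suc r)"
            using r r' inj[of r] by (auto dest: Suc_lessD)
          then show ?thesis using False A1[OF r', of i] 1(1) r by (simp add: \<Phi>_def)
        next
          case 2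
          then show ?thesis using False A2[of i] k by (simp add: \<Phi>_def)
        qed
      qed
      then have "\<Phi> (\<lambda>(k, i, j). A $ k $ i $ j) = A" by (simp add: vec_eq_iff)
      then show "f A = 0" using f0 by metis
    qed
  qed
qed

section \<open>Traces of words\<close>

lemma polynomial_functions_sum:
  "finite B \<Longrightarrow> (\<And>b. b \<in> B \<Longrightarrow> f b \<in> polynomial_functions) \<Longrightarrow> (\<lambda>A. \<Sum>b\<in>B. f b A) \<in> polynomial_functions"
  by (induction B rule: finite_induct) (auto intro: polynomial_functions.intros)

lemma polynomial_functions_prod:
  "finite B \<Longrightarrow> (\<And>b. b \<in> B \<Longrightarrow> f b \<in> polynomial_functions) \<Longrightarrow> (\<lambda>A. \<Prod>b\<in>B. f b A) \<in> polynomial_functions"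
  by (induction B rule: finite_induct) (auto intro: polynomial_functions.intros)

text \<open>The polynomial covariants with values in matrices. They admit products, so projections
  onto coordinates can be inserted into words before the trace is taken.\<close>

definition equivariant :: "(('p::finite, 'n::finite) mat_tuple \<Rightarrow> complex^'p^'p) \<Rightarrow> bool" where
  "equivariant W \<longleftrightarrow> (\<forall>i j. (\<lambda>A. W A $ i $ j) \<in> polynomial_functions) \<and>
     (\<forall>g A. invertible g \<longrightarrow> W (conj_action g A) = g ** W A ** matrix_inv g)"

lemma equivariant_entry: "equivariant (\<lambda>A. A $ k)"
  by (simp add: equivariant_def polynomial_functions.entry conj_action_def)

lemma equivariant_mult:
  assumes "equivariant V" "equivariant W"
  shows "equivariant (\<lambda>A. V A ** W A)"
  unfolding equivariant_def
proof (intro conjI allI impI)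
  show "(\<lambda>A. (V A ** W A) $ i $ j) \<in> polynomial_functions" for i j
    using assms unfolding equivariant_def matrix_matrix_mult_def
    by (simp add: polynomial_functions_sum polynomial_functions.mult)
  fix g :: "complex^'a^'a" and A :: "('a, 'b) mat_tuple" assume g: "invertible g"
  have "V (conj_action g A) ** W (conj_action g A) =
      (g ** V A ** matrix_inv g) ** (g ** W A ** matrix_inv g)"
    using assms g by (simp add: equivariant_def)
  also have "\<dots> = g ** V A ** (matrix_inv g ** g) ** W A ** matrix_inv g"
    by (simp only: matrix_mul_assoc)
  finally show "V (conj_action g A) ** W (conj_action g A) = g ** (V A ** W A) ** matrix_inv g"
    by (simp add: matrix_inv_inverse[OF g] matrix_mul_assoc)
qed

lemma equivariant_mat: "equivariant (\<lambda>A. mat c)"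
  unfolding equivariant_def
proof (intro conjI allI impI)
  show "(\<lambda>A. mat c $ i $ j) \<in> polynomial_functions" for i j
    by (rule polynomial_functions.const)
  fix g :: "complex^'a^'a" assume g: "invertible g"
  have "g ** mat c = mat c ** g"
    by (simp add: vec_eq_iff matrix_matrix_mult_def mat_def if_distrib[of "\<lambda>a. a * _"]
        if_distrib[of "\<lambda>a. _ * a"] mult.commute cong: if_cong)
  then have "g ** mat c ** matrix_inv g = mat c ** (g ** matrix_inv g)" by (simp add: matrix_mul_assoc)
  then show "mat c = g ** mat c ** matrix_inv g" by (simp add: matrix_inv_inverse[OF g])
qed

lemma equivariant_diff:
  assumes "equivariant V" "equivariant W"
  shows "equivariant (\<lambda>A. V A - W A)"
  unfolding equivariant_def
proof (intro conjI allI impI)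
  show "(\<lambda>A. (V A - W A) $ i $ j) \<in> polynomial_functions" for i j
    using polynomial_functions.add[of "\<lambda>A. V A $ i $ j" "\<lambda>A. -1 * W A $ i $ j"]
      polynomial_functions.mult[OF polynomial_functions.const[of "-1"], of "\<lambda>A. W A $ i $ j"] assms
    by (simp add: equivariant_def)
  show "V (conj_action g A) - W (conj_action g A) = g ** (V A - W A) ** matrix_inv g"
    if "invertible g" for g :: "complex^'a^'a" and A :: "('a, 'b) mat_tuple"
    using assms that by (simp add: equivariant_def vec_eq_iff matrix_matrix_mult_def
        right_diff_distrib left_diff_distrib sum_subtractf)
qed

lemma trace_invariant:
  assumes "equivariant W"
  shows "(\<lambda>A. trace (W A)) \<in> invariants"
  unfolding invariants_def
proof (intro CollectI conjI ballI allI)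
  show "(\<lambda>A. trace (W A)) \<in> polynomial_functions"
    using assms unfolding trace_def equivariant_def by (simp add: polynomial_functions_sum)
  fix g :: "complex^'a^'a" and A :: "('a, 'b) mat_tuple" assume "g \<in> general_linear_group"
  then have g: "invertible g" by (simp add: general_linear_group_def)
  have "trace (g ** W A ** matrix_inv g) = trace (W A ** (matrix_inv g ** g))"
    by (metis trace_mul_sym matrix_mul_assoc)
  then show "trace (W (conj_action g A)) = trace (W A)"
    using assms g by (simp add: equivariant_def matrix_inv_inverse)
qed

lemma det_invariant:
  assumes "equivariant W"
  shows "(\<lambda>A. det (W A)) \<in> invariants"
  unfolding invariants_def
proof (intro CollectI conjI ballI allI)
  show "(\<lambda>A. det (W A)) \<in> polynomial_functions"
    unfolding det_def
  proof (intro polynomial_functions_sum polynomial_functions.mult polynomial_functions.const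
      polynomial_functions_prod finite_permutations finite)
    show "(\<lambda>A. W A $ i $ j) \<in> polynomial_functions" for i j using assms by (simp add: equivariant_def)
  qed
  fix g :: "complex^'a^'a" and A :: "('a, 'b) mat_tuple" assume "g \<in> general_linear_group"
  then have g: "invertible g" by (simp add: general_linear_group_def)
  have "det (g ** W A ** matrix_inv g) = det (W A) * det (g ** matrix_inv g)"
    by (simp add: det_mul)
  then show "det (W (conj_action g A)) = det (W A)"
    using assms g by (simp add: equivariant_def matrix_inv_inverse)
qed

text \<open>The monic polynomial with the list of roots \<open>cs\<close>, evaluated at the matrix
  \<open>M\<close>.\<close>

definition shift_product :: "complex list \<Rightarrow> complex^'p^'p \<Rightarrow> complex^'p^'p" where
  "shift_product cs M = foldr (\<lambda>c N. (M - mat c) ** N) cs (mat 1)"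

definition diag_mat :: "('p \<Rightarrow> complex) \<Rightarrow> complex^'p^'p" where
  "diag_mat d = (\<chi> i j. if i = j then d i else 0)"

lemma diag_mat_mult: "(diag_mat d ** M) $ i $ j = d i * M $ i $ j"
  by (simp add: matrix_matrix_mult_def diag_mat_def if_distrib[of "\<lambda>a. a * _"] cong: if_cong)

lemma mult_diag_mat: "(M ** diag_mat d) $ i $ j = M $ i $ j * d j"
  by (simp add: matrix_matrix_mult_def diag_mat_def if_distrib[of "\<lambda>a. _ * a"] cong: if_cong)

lemma equivariant_shift_product: "equivariant (\<lambda>A. shift_product cs (A $ k))"
proof (induction cs)
  case Nil
  show ?case by (simp add: shift_product_def equivariant_mat)
next
  case (Cons c cs)
  then show ?case
    using equivariant_mult[OF equivariant_diff[OF equivariant_entry equivariant_mat] Cons]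
    by (simp add: shift_product_def)
qed

lemma shift_product_diag: "shift_product cs (diag_mat d) = diag_mat (\<lambda>i. \<Prod>c\<leftarrow>cs. d i - c)"
proof (induction cs)
  case Nil
  show ?case by (simp add: shift_product_def diag_mat_def mat_def)
next
  case (Cons c cs)
  have "diag_mat d - mat c = diag_mat (\<lambda>i. d i - c)" by (simp add: diag_mat_def mat_def vec_eq_iff)
  then have "shift_product (c # cs) (diag_mat d) = diag_mat (\<lambda>i. d i - c) ** diag_mat (\<lambda>i. \<Prod>c\<leftarrow>cs. d i - c)"
    using Cons by (simp add: shift_product_def)
  also have "\<dots> = diag_mat (\<lambda>i. \<Prod>c\<leftarrow>c # cs. d i - c)"
    unfolding vec_eq_iff diag_mat_mult by (simp add: diag_mat_def)
  finally show ?case .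
qed

text \<open>Lagrange interpolation: the polynomial whose roots are the \<open>d j\<close> with
  \<open>j \<noteq> i\<close>, evaluated at \<open>A $ k1\<close>. It is equivariant on all tuples,
  and where \<open>A $ k1\<close> is \<open>diag_mat d\<close> it is a nonzero multiple of the
  projection onto coordinate \<open>i\<close>.\<close>

lemma exists_equivariant_projections:
  fixes d :: "'p::finite \<Rightarrow> complex" and k1 :: "'n::finite"
  assumes "inj d"
  shows "\<exists>E c. \<forall>i. equivariant (E i :: ('p, 'n) mat_tuple \<Rightarrow> _) \<and> c i \<noteq> 0 \<and>
    (\<forall>A. A $ k1 = diag_mat d \<longrightarrow> E i A = diag_mat (\<lambda>j. if j = i then c i else 0))"
proof -
  have "\<exists>W c. equivariant (W :: ('p, 'n) mat_tuple \<Rightarrow> _) \<and> c \<noteq> 0 \<and>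
    (\<forall>A. A $ k1 = diag_mat d \<longrightarrow> W A = diag_mat (\<lambda>j. if j = i then c else 0))" for i
  proof -
    obtain cs where cs: "set cs = d ` (UNIV - {i})" using finite_list[of "d ` (UNIV - {i})"] by auto
    have "(\<Prod>c\<leftarrow>cs. d j - c) = 0" if "j \<noteq> i" for j
      using cs that by (auto simp: prod_list_zero_iff image_iff)
    then have "(\<lambda>j. \<Prod>c\<leftarrow>cs. d j - c) = (\<lambda>j. if j = i then (\<Prod>c\<leftarrow>cs. d i - c) else 0)" by auto
    moreover have "(\<Prod>c\<leftarrow>cs. d i - c) \<noteq> 0"
      using cs assms by (auto simp: prod_list_zero_iff image_iff inj_eq)
    ultimately show ?thesis
      using equivariant_shift_product[of cs k1]
      by (intro exI[of _ "\<lambda>A. shift_product cs (A $ k1)"] exI[of _ "\<Prod>c\<leftarrow>cs. d i - c"])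
        (simp add: shift_product_diag)
  qed
  then show ?thesis by metis
qed

text \<open>With projections \<open>E i\<close>, \<open>E j\<close>, \<open>E l\<close> inserted
  between the letters, the trace of a word is \<open>c i * c j * c l\<close> times the product of
  entries along the closed walk through \<open>i\<close>, \<open>j\<close>,
  \<open>l\<close>.\<close>

lemma invariants_eq_imp_cycles_eq:
  fixes A B :: "('p::finite, 'n::finite) mat_tuple"
  assumes eq: "\<And>f. f \<in> invariants \<Longrightarrow> f A = f B" and d: "inj d"
    and A: "A $ k1 = diag_mat d" and B: "B $ k1 = diag_mat d"
  shows "A $ k $ i $ i = B $ k $ i $ i"
    and "A $ k $ i $ j * A $ k' $ j $ i = B $ k $ i $ j * B $ k' $ j $ i"
    and "A $ k $ i $ j * A $ k' $ j $ l * A $ k'' $ l $ i = B $ k $ i $ j * B $ k' $ j $ l * B $ k'' $ l $ i"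
proof -
  obtain E :: "'p \<Rightarrow> ('p, 'n) mat_tuple \<Rightarrow> complex^'p^'p" and c where
    E: "\<And>i. equivariant (E i)" "\<And>i. c i \<noteq> 0"
      "\<And>i A. A $ k1 = diag_mat d \<Longrightarrow> E i A = diag_mat (\<lambda>j. if j = i then c i else 0)"
    using exists_equivariant_projections[OF d, of k1] by metis
  have EM: "(E i C ** M) $ r $ s = (if r = i then c i * M $ i $ s else 0)"
    if "C $ k1 = diag_mat d" for C i r s and M :: "complex^'p^'p"
    unfolding E(3)[OF that] diag_mat_mult by simp
  have trE: "trace (E i C ** M) = c i * M $ i $ i" if "C $ k1 = diag_mat d" for C i and M :: "complex^'p^'p"
    unfolding trace_def EM[OF that] by simp
  have MEM: "(N ** (E i C ** M)) $ r $ s = N $ r $ i * (c i * M $ i $ s)"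
    if "C $ k1 = diag_mat d" for C i r s and M N :: "complex^'p^'p"
    unfolding matrix_matrix_mult_def[of N] using EM[OF that]
    by (simp add: if_distrib[of "\<lambda>a. _ * a"] cong: if_cong)
  note eqv = equivariant_mult equivariant_entry E(1)
  note simps = trE[OF A] trE[OF B] MEM[OF A] MEM[OF B]
  have "(\<lambda>C. trace (E i C ** C $ k)) \<in> invariants" by (intro trace_invariant eqv)
  from eq[OF this] show "A $ k $ i $ i = B $ k $ i $ i" by (simp add: simps E(2))
  have "(\<lambda>C. trace (E i C ** (C $ k ** (E j C ** C $ k')))) \<in> invariants"
    by (intro trace_invariant eqv)
  from eq[OF this]
  have "(c i * c j) * (A $ k $ i $ j * A $ k' $ j $ i) = (c i * c j) * (B $ k $ i $ j * B $ k' $ j $ i)"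
    by (simp only: simps mult_ac)
  then show "A $ k $ i $ j * A $ k' $ j $ i = B $ k $ i $ j * B $ k' $ j $ i"
    using E(2) by simp
  have "(\<lambda>C. trace (E i C ** (C $ k ** (E j C ** (C $ k' ** (E l C ** C $ k'')))))) \<in> invariants"
    by (intro trace_invariant eqv)
  from eq[OF this]
  have "(c i * c j * c l) * (A $ k $ i $ j * A $ k' $ j $ l * A $ k'' $ l $ i) =
      (c i * c j * c l) * (B $ k $ i $ j * B $ k' $ j $ l * B $ k'' $ l $ i)"
    by (simp only: simps mult_ac)
  then show "A $ k $ i $ j * A $ k' $ j $ l * A $ k'' $ l $ i = B $ k $ i $ j * B $ k' $ j $ l * B $ k'' $ l $ i"
    using E(2) by simp
qed

text \<open>The eigenvalue \<open>d i\<close> persists in \<open>B $ k1\<close>, as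
  \<open>det (C $ k1 - mat (d i))\<close> is an invariant of \<open>C\<close>. For an eigenvector
  \<open>v\<close> and \<open>s\<close> the sum of the \<open>\<epsilon> j * v $ j\<close>, row
  \<open>i\<close> gives \<open>s = 0\<close>, and the other rows then leave only
  \<open>v $ i\<close>, so \<open>\<epsilon> i * v $ i = 0\<close>. The rank-one shape matters: a
  diagonal perturbation could permute the values of \<open>d\<close> and keep the spectrum.\<close>

lemma rank_one_perturbation_eq_0:
  fixes A B :: "('p::finite, 'n::finite) mat_tuple"
  assumes eq: "\<And>f. f \<in> invariants \<Longrightarrow> f A = f B" and d: "inj d"
    and A: "A $ k1 = diag_mat d" and B: "B $ k1 = diag_mat d + (\<chi> i j. \<epsilon> j)"
  shows "\<epsilon> i = 0"
proof (rule ccontr)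
  assume \<epsilon>: "\<epsilon> i \<noteq> 0"
  have "(\<lambda>C. det (C $ k1 - mat (d i))) \<in> invariants"
    by (intro det_invariant equivariant_diff equivariant_entry equivariant_mat)
  from eq[OF this] have detAB: "det (A $ k1 - mat (d i)) = det (B $ k1 - mat (d i))" .
  have mv: "((diag_mat d - mat (d i)) *v v) $ r = (d r - d i) * v $ r" for v r
  proof -
    have "((diag_mat d - mat (d i)) *v v) $ r = (\<Sum>j\<in>UNIV. (diag_mat d - mat (d i)) $ r $ j * v $ j)"
      by (simp add: matrix_vector_mult_def)
    also have "\<dots> = (\<Sum>j\<in>UNIV. if j = r then (d r - d i) * v $ j else 0)"
      by (intro sum.cong) (auto simp: diag_mat_def mat_def)
    finally show ?thesis by simp
  qed
  have "(A $ k1 - mat (d i)) *v axis i 1 = 0" by (simp add: vec_eq_iff A mv) (simp add: axis_def)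
  moreover have "axis i (1 :: complex) \<noteq> 0" by simp
  ultimately have "det (A $ k1 - mat (d i)) = 0" using det_eq_0_kernel by blast
  then obtain v where v: "v \<noteq> 0" "(B $ k1 - mat (d i)) *v v = 0"
    using detAB det_eq_0_kernel[of "B $ k1 - mat (d i)"] by auto
  define s where "s = (\<Sum>j\<in>UNIV. \<epsilon> j * v $ j)"
  have "B $ k1 - mat (d i) = (diag_mat d - mat (d i)) + (\<chi> i j. \<epsilon> j)" by (simp add: B)
  then have "(B $ k1 - mat (d i)) *v v = (diag_mat d - mat (d i)) *v v + (\<chi> i j. \<epsilon> j) *v v"
    by (simp only: matrix_vector_mult_add_rdistrib)
  moreover have "((\<chi> i j. \<epsilon> j) *v v) $ r = s" for r :: 'p
    by (simp add: matrix_vector_mult_def s_def)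
  ultimately have "((B $ k1 - mat (d i)) *v v) $ r = (d r - d i) * v $ r + s" for r
    by (simp only: vector_add_component mv)
  then have row: "(d r - d i) * v $ r + s = 0" for r using v(2) by simp
  have "s = 0" using row[of i] by simp
  then have vr: "v $ r = 0" if "r \<noteq> i" for r using row[of r] d that by (auto simp: inj_eq)
  have "s = (\<Sum>j\<in>UNIV. if j = i then \<epsilon> i * v $ i else 0)"
    unfolding s_def using vr by (intro sum.cong) auto
  then have "v $ i = 0" using \<open>s = 0\<close> \<epsilon> by simp
  then have "v $ r = 0" for r using vr by (cases "r = i") auto
  then show False using v(1) by (simp add: vec_eq_iff)
qed

section \<open>The transversal slice\<close>

lemma invariants_intertwined:
  assumes f: "f \<in> invariants" and g: "invertible g" and AB: "\<And>k. g ** A $ k = B $ k ** g"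
  shows "f A = f B"
proof -
  have "B $ k = g ** A $ k ** matrix_inv g" for k
    by (simp add: AB matrix_mul_assoc[symmetric] matrix_inv_inverse[OF g])
  then have "B = conj_action g A" by (simp add: conj_action_def vec_eq_iff)
  then show ?thesis using f g by (simp add: invariants_def general_linear_group_def)
qed

text \<open>
  The blocks \<open>{a}\<close>, \<open>- {a, b}\<close>, \<open>{b}\<close>, in this order; a strictly upper block entry can be scaled
  to \<open>0\<close> by a one-parameter subgroup.
\<close>

definition upper :: "'p \<Rightarrow> 'p \<Rightarrow> 'p \<Rightarrow> 'p \<Rightarrow> bool" where
  "upper a b i j \<longleftrightarrow> (i = a \<and> j \<noteq> a) \<or> (j = b \<and> i \<noteq> b)"

text \<open>Conjugation by the diagonal matrix with \<open>t\<close> at \<open>a\<close>,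
  \<open>1 / t\<close> at \<open>b\<close> and \<open>1\<close> elsewhere multiplies the entries
  from \<open>a\<close> to the middle and from the middle to \<open>b\<close> by \<open>t\<close>;
  the corner entry, of weight \<open>t^2\<close>, is zero. So \<open>f\<close> is constant on the
  family for nonzero \<open>t\<close>, hence also at \<open>t = 0\<close>.\<close>

lemma invariants_block_diagonal_part:
  fixes A :: "('p::finite, 'n::finite) mat_tuple"
  assumes f: "f \<in> invariants" and ab: "a \<noteq> b"
    and lower: "\<And>k i j. upper a b j i \<Longrightarrow> A $ k $ i $ j = 0" and corner: "\<And>k. A $ k $ a $ b = 0"
  shows "f A = f (\<chi> k i j. if upper a b i j then 0 else A $ k $ i $ j)"
proof -
  define \<Gamma> where "\<Gamma> t = (\<chi> k i j. if upper a b i j then t * A $ k $ i $ j else A $ k $ i $ j)" for t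
  have poly: "(\<lambda>x. \<Gamma> (x ()) $ k $ i $ j) \<in> poly_funs {()}" for k i j
    by (cases "upper a b i j")
      (simp_all add: \<Gamma>_def poly_funs.const poly_funs.mult poly_funs.var)
  have fpoly: "(\<lambda>x. f (\<Gamma> (x ()))) \<in> poly_funs {()}"
    using f by (intro polynomial_functions_comp[OF _ poly]) (simp add: invariants_def)
  have off0: "f (\<Gamma> t) = f A" if "t \<notin> {0}" for t
  proof -
    define \<gamma> where "\<gamma> i = (if i = a then t else if i = b then 1 / t else 1)" for i
    have "det (diag_mat \<gamma>) = (\<Prod>i\<in>UNIV. \<gamma> i)"
      by (subst det_diagonal) (auto simp: diag_mat_def)
    also have "\<dots> \<noteq> 0" using that by (simp add: \<gamma>_def)
    finally have inv: "invertible (diag_mat \<gamma>)" by (simp add: invertible_det_nz)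
    have "diag_mat \<gamma> ** A $ k = \<Gamma> t $ k ** diag_mat \<gamma>" for k
    proof -
      have "\<gamma> i * A $ k $ i $ j = \<Gamma> t $ k $ i $ j * \<gamma> j" for i j
      proof (cases "upper a b j i \<or> (i = a \<and> j = b)")
        case True
        then show ?thesis using lower[of j i] corner[of k] by (auto simp: \<Gamma>_def)
      next
        case False
        then show ?thesis using that ab by (auto simp: \<Gamma>_def \<gamma>_def upper_def)
      qed
      then show ?thesis by (simp add: vec_eq_iff diag_mat_mult mult_diag_mat)
    qed
    from invariants_intertwined[OF f inv, of A "\<Gamma> t", OF this] show ?thesis by simp
  qed
  from poly_funs_eq_off_finite[OF fpoly poly_funs.const[of "f A"], of "{0}" 0, OF _ off0]
  have "f (\<Gamma> 0) = f A" by simp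
  moreover have "\<Gamma> 0 = (\<chi> k i j. if upper a b i j then 0 else A $ k $ i $ j)"
    by (simp add: \<Gamma>_def vec_eq_iff)
  ultimately show ?thesis by simp
qed

text \<open>
  In a cycle through a lower block entry of \<open>x\<close>, choose the upper entries at position \<open>\<sigma>\<close>, where
  \<open>x\<close> is \<open>1\<close> and \<open>y\<close> vanishes.
\<close>

lemma cycles_eq_imp_lower_eq_0:
  fixes x y :: "'n \<Rightarrow> 'p \<Rightarrow> 'p \<Rightarrow> complex"
  assumes cyc2: "\<And>k i j k'. k \<noteq> k1 \<Longrightarrow> k' \<noteq> k1 \<Longrightarrow> x k i j * x k' j i = y k i j * y k' j i"
    and cyc3: "\<And>k i j k' l k''. k \<noteq> k1 \<Longrightarrow> k' \<noteq> k1 \<Longrightarrow> k'' \<noteq> k1 \<Longrightarrow>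
      x k i j * x k' j l * x k'' l i = y k i j * y k' j l * y k'' l i"
    and middle: "\<And>k i j. k \<noteq> k1 \<Longrightarrow> i \<notin> {a, b} \<Longrightarrow> j \<notin> {a, b} \<Longrightarrow> i \<noteq> j \<Longrightarrow> x k i j = 1"
    and \<sigma>: "ks \<noteq> k1" "js \<notin> {a, b}"
    and xu: "x ks a js = 1" "x ks js b = 1" and yu: "y ks a js = 0" "y ks js b = 0"
    and k: "k \<noteq> k1"
  shows "i \<notin> {a, b} \<Longrightarrow> x k i a = 0" "i \<notin> {a, b} \<Longrightarrow> x k b i = 0" "x k b a = 0"
proof -
  show "x k i a = 0" if i: "i \<notin> {a, b}"
  proof (cases "i = js")
    case True
    then show ?thesis using cyc2[OF \<sigma>(1) k, of a js] xu yu by simp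
  next
    case False
    then have "x ks js i = 1" using middle[OF \<sigma>(1) \<sigma>(2) i] by simp
    then show ?thesis using cyc3[OF \<sigma>(1) \<sigma>(1) k, of a js i] xu yu by simp
  qed
  show "x k b i = 0" if i: "i \<notin> {a, b}"
  proof (cases "i = js")
    case True
    then show ?thesis using cyc2[OF k \<sigma>(1), of b js] xu yu by simp
  next
    case False
    then have "x ks i js = 1" using middle[OF \<sigma>(1) i \<sigma>(2)] by simp
    then show ?thesis using cyc3[OF k \<sigma>(1) \<sigma>(1), of b i js] xu yu by simp
  qed
  show "x k b a = 0" using cyc3[OF \<sigma>(1) \<sigma>(1) k, of a js b] xu yu by simp
qed

text \<open>Closed walks do not change under conjugation by diagonal matrices. The star of entries
  from \<open>m0\<close> removes this freedom on the middle block: two-step walks through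
  \<open>m0\<close> fix all entries into and out of \<open>m0\<close>, and triangles at
  \<open>m0\<close> fix the others.\<close>

lemma cycles_eq_imp_middle_eq_1:
  fixes x y :: "'n \<Rightarrow> 'p \<Rightarrow> 'p \<Rightarrow> complex"
  assumes cyc2: "\<And>k i j k'. k \<noteq> k1 \<Longrightarrow> k' \<noteq> k1 \<Longrightarrow> x k i j * x k' j i = y k i j * y k' j i"
    and cyc3: "\<And>k i j k' l k''. k \<noteq> k1 \<Longrightarrow> k' \<noteq> k1 \<Longrightarrow> k'' \<noteq> k1 \<Longrightarrow>
      x k i j * x k' j l * x k'' l i = y k i j * y k' j l * y k'' l i"
    and middle: "\<And>k i j. k \<noteq> k1 \<Longrightarrow> i \<in> M \<Longrightarrow> j \<in> M \<Longrightarrow> i \<noteq> j \<Longrightarrow> x k i j = 1"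
    and m0: "m0 \<in> M" and k2: "k2 \<noteq> k1"
    and star: "\<And>j. j \<in> M \<Longrightarrow> j \<noteq> m0 \<Longrightarrow> y k2 m0 j = 1"
    and "k \<noteq> k1" "i \<in> M" "j \<in> M" "i \<noteq> j"
  shows "y k i j = 1"
proof -
  have to_m0: "y k j m0 = 1" if "k \<noteq> k1" "j \<in> M" "j \<noteq> m0" for k j
    using cyc2[OF k2 that(1), of m0 j] middle[OF k2 m0 that(2)] middle[OF that(1,2) m0] star[OF that(2,3)] that
    by simp
  have from_m0: "y k m0 j = 1" if "k \<noteq> k1" "j \<in> M" "j \<noteq> m0" for k j
    using cyc2[OF that(1) k2, of m0 j] middle[OF that(1) m0 that(2)] middle[OF k2 that(2) m0] to_m0[OF k2 that(2,3)] that
    by simp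
  consider "i = m0" | "j = m0" | "i \<noteq> m0" "j \<noteq> m0" by blast
  then show ?thesis
  proof cases
    case 1
    then show ?thesis using from_m0 assms by auto
  next
    case 2
    then show ?thesis using to_m0 assms by auto
  next
    case 3
    then show ?thesis
      using cyc3[OF k2 \<open>k \<noteq> k1\<close> k2, of m0 i j] middle[OF k2 m0 \<open>i \<in> M\<close>] middle[OF \<open>k \<noteq> k1\<close> \<open>i \<in> M\<close> \<open>j \<in> M\<close> \<open>i \<noteq> j\<close>]
        middle[OF k2 \<open>j \<in> M\<close> m0] star[OF \<open>i \<in> M\<close>] to_m0[OF k2 \<open>j \<in> M\<close>] by simp
  qed
qed

theorem separating_set_card_ge:
  fixes S :: "(('p::finite, 'n::finite) mat_tuple \<Rightarrow> complex) set"
  assumes np: "(CARD('n) \<ge> 2 \<and> CARD('p) \<ge> 4) \<or> (CARD('n) \<ge> 3 \<and> CARD('p) = 3)"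
    and S: "separating_set S" "finite S"
  shows "(CARD('n) - 1) * CARD('p)\<^sup>2 + 3 \<le> card S"
proof -
  let ?p = "CARD('p)" and ?n = "CARD('n)"
  have S_inv: "S \<subseteq> invariants"
    and S_sep: "\<And>v w. (\<forall>s\<in>S. s v = s w) \<longleftrightarrow> (\<forall>f\<in>invariants. f v = f w)"
    using S(1) by (auto simp: separating_set_def)
  obtain k1 k2 :: 'n where k2: "k2 \<noteq> k1"
    using np by (metis card_2_iff' ex_card UNIV_I le_trans numeral_le_iff semiring_norm(68,69,71,72))
  obtain a b m0 :: 'p where abm: "a \<noteq> b" "m0 \<notin> {a, b}"
  proof -
    have "3 \<le> card (UNIV :: 'p set)" using np by auto
    then obtain T :: "'p set" where "card T = 3" using obtain_subset_with_card_n by metis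
    then show ?thesis using that by (auto simp: card_3_iff)
  qed
  define M where "M = UNIV - {a, b}"
  have m0: "m0 \<in> M" using abm by (simp add: M_def)
  have cardM: "card M = ?p - 2" using abm by (simp add: M_def card_Diff_subset)
  have cardN: "card (UNIV - {k1}) = ?n - 1" by (simp add: card_Diff_subset)
  have "2 \<le> (?n - 1) * (?p - 2)"
    using np
  proof
    assume "?n \<ge> 2 \<and> ?p \<ge> 4"
    then have "1 \<le> ?n - 1" "2 \<le> ?p - 2" by linarith+
    then show ?thesis using mult_le_mono[of 1 "?n - 1" 2 "?p - 2"] by simp
  next
    assume "?n \<ge> 3 \<and> ?p = 3"
    then have "2 \<le> ?n - 1" "1 \<le> ?p - 2" by linarith+
    then show ?thesis using mult_le_mono[of 2 "?n - 1" 1 "?p - 2"] by simp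
  qed
  also have "\<dots> = card ((UNIV - {k1}) \<times> M)" by (simp add: card_cartesian_product cardM cardN)
  finally obtain T where "T \<subseteq> (UNIV - {k1}) \<times> M" "card T = 2"
    by (rule obtain_subset_with_card_n)
  then obtain \<sigma> \<tau> where \<sigma>\<tau>: "\<sigma> \<in> (UNIV - {k1}) \<times> M" "\<tau> \<in> (UNIV - {k1}) \<times> M" "\<sigma> \<noteq> \<tau>"
    by (auto simp: card_2_iff)
  obtain ks js kt jt where st: "\<sigma> = (ks, js)" "\<tau> = (kt, jt)" by (metis surj_pair)
  then have ks: "ks \<noteq> k1" "js \<notin> {a, b}" and kt: "kt \<noteq> k1" "jt \<notin> {a, b}" using \<sigma>\<tau> by (auto simp: M_def)
  obtain \<iota> :: "'p \<Rightarrow> nat" where "inj \<iota>" using finite_imp_inj_to_nat_seg[of "UNIV :: 'p set"] by auto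
  then have d: "inj (\<lambda>i. of_nat (\<iota> i) :: complex)" by (auto simp: inj_def)
  define d where "d = (\<lambda>i. of_nat (\<iota> i) :: complex)"
  have d: "inj d" using d by (simp add: d_def)

  \<comment> \<open>The reference tuple outside \<open>k1\<close>: zero on the diagonal and below
    the blocks, \<open>1\<close> at all other middle entries. For \<open>\<rho> = (k, j)\<close> the
    only nonzero upper entries are those at \<open>(a, j)\<close> and \<open>(j, b)\<close> of the
    \<open>k\<close>-th matrix, and the corner is zero.\<close>
  define base :: "'n \<times> 'p \<Rightarrow> 'n \<Rightarrow> 'p \<Rightarrow> 'p \<Rightarrow> complex" where
    "base \<rho> k i j = (if i = j then 0 else if i = a then (if (k, j) = \<rho> then 1 else 0)
      else if j = b then (if (k, i) = \<rho> then 1 else 0) else if j = a \<or> i = b then 0 else 1)" for \<rho> k i j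
  \<comment> \<open>The indices without a parameter: \<open>p^2 - p\<close> of them for
    \<open>k1\<close>, where one parameter per column remains, and the \<open>p - 3\<close> entries
    of the star. This leaves \<open>n p^2 - (p^2 - p) - (p - 3) = (n - 1) p^2 + 3\<close>.\<close>
  define U where "U = {k1} \<times> {(i, j). i \<noteq> j} \<union> {k2} \<times> ({m0} \<times> (M - {m0}))"
  define I where "I = UNIV - U"
  \<comment> \<open>\<open>Y\<close> has fixed upper entries, so the upper indices are free for
    \<open>X\<close>: the parameter at an upper index is the entry of \<open>X\<close> at the
    transposed, lower position. The other parameters for \<open>k \<noteq> k1\<close> are the
    deviations of \<open>Y\<close> from \<open>base \<tau>\<close>.\<close>
  define X where "X u = (\<chi> k i j. if k = k1 then diag_mat d $ i $ j
    else if upper a b j i then u (k, j, i) else base \<sigma> k i j)" for u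
  define Y where "Y u = (\<chi> k i j. if k = k1 then diag_mat d $ i $ j + u (k1, j, j)
    else if upper a b i j then base \<tau> k i j
    else (if (k, i, j) \<in> I then u (k, i, j) else 0) + base \<tau> k i j)" for u

  have card_offdiag: "card {(i, j). i \<noteq> (j :: 'p)} = ?p * ?p - ?p"
  proof -
    have "{(i, j). i \<noteq> (j :: 'p)} = UNIV - (\<lambda>i. (i, i)) ` UNIV" by auto
    moreover have "card ((\<lambda>i. (i, i)) ` (UNIV :: 'p set)) = ?p" by (intro card_image) (simp add: inj_def)
    ultimately show ?thesis by (simp add: card_Diff_subset card_prod)
  qed
  have "card U = (?p * ?p - ?p) + (?p - 3)"
    unfolding U_def using k2 m0
    by (subst card_Un_disjoint) (auto simp: card_cartesian_product card_offdiag card_Diff_subset cardM)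
  then have "card I = ?n * (?p * ?p) - ((?p * ?p - ?p) + (?p - 3))"
    unfolding I_def by (simp add: card_Diff_subset card_prod)
  moreover have "(?p * ?p - ?p) + (?p - 3) + 3 = ?p * ?p"
  proof -
    have "3 \<le> ?p" using np by auto
    then have "3 * ?p \<le> ?p * ?p" by simp
    then show ?thesis using \<open>3 \<le> ?p\<close> by linarith
  qed
  moreover have "?n * (?p * ?p) = (?n - 1) * (?p * ?p) + ?p * ?p"
    using np by (cases ?n) auto
  ultimately have cardI: "card I = (?n - 1) * ?p\<^sup>2 + 3" by (simp add: power2_eq_square)

  have X_poly: "(\<lambda>u. X u $ k $ i $ j) \<in> poly_funs I" for k i j
  proof -
    have "(k, j, i) \<in> I" if "k \<noteq> k1" "upper a b j i"
      using that m0 by (auto simp: I_def U_def upper_def M_def)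
    then show ?thesis
      by (cases "k = k1"; cases "upper a b j i") (simp_all add: X_def poly_funs.const poly_funs.var)
  qed
  have Y_poly: "(\<lambda>u. Y u $ k $ i $ j) \<in> poly_funs I" for k i j
  proof (cases "k = k1")
    case True
    have "(k1, j, j) \<in> I" using k2 by (auto simp: I_def U_def)
    then show ?thesis using True
      by (simp add: Y_def poly_funs.const poly_funs.add poly_funs.var)
  next
    case False
    then show ?thesis
      by (cases "upper a b i j"; cases "(k, i, j) \<in> I")
        (simp_all add: Y_def poly_funs.const poly_funs.add poly_funs.var)
  qed

  have "card I \<le> card S"
  proof (rule card_vars_le_card_equations[where F = "\<lambda>s u. s (X u) - s (Y u)"])
    show "finite I" by simp
    show "finite S" by (rule S(2))
    show "(\<lambda>u. s (X u) - s (Y u)) \<in> poly_funs I" if "s \<in> S" for s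
    proof -
      have "s \<in> polynomial_functions" using that S_inv by (auto simp: invariants_def)
      then show ?thesis
        by (intro poly_funs_minus polynomial_functions_comp[OF _ X_poly] polynomial_functions_comp[OF _ Y_poly])
    qed
    show "s (X (\<lambda>_. 0)) - s (Y (\<lambda>_. 0)) = 0" if "s \<in> S" for s
    proof -
      have s: "s \<in> invariants" using that S_inv by blast
      \<comment> \<open>At the origin both tuples are block upper triangular with zero corner and
        equal diagonal blocks. They differ only in the upper entries, at \<open>\<sigma>\<close> and
        \<open>\<tau>\<close>, which invariants do not see.\<close>
      have "s (X (\<lambda>_. 0)) = s (\<chi> k i j. if upper a b i j then 0 else X (\<lambda>_. 0) $ k $ i $ j)"
        using abm(1) ks by (intro invariants_block_diagonal_part s)
          (auto simp: X_def upper_def diag_mat_def base_def st)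
      moreover have "s (Y (\<lambda>_. 0)) = s (\<chi> k i j. if upper a b i j then 0 else Y (\<lambda>_. 0) $ k $ i $ j)"
        using abm(1) kt by (intro invariants_block_diagonal_part s)
          (auto simp: Y_def upper_def diag_mat_def base_def st)
      moreover have "(\<chi> k i j. if upper a b i j then 0 else X (\<lambda>_. 0) $ k $ i $ j) =
          (\<chi> k i j. if upper a b i j then 0 else Y (\<lambda>_. 0) $ k $ i $ j)"
        by (auto simp: vec_eq_iff X_def Y_def upper_def base_def)
      ultimately show ?thesis by simp
    qed
    fix u v assume zero: "\<And>s. s \<in> S \<Longrightarrow> s (X u) - s (Y u) = 0" and v: "v \<in> I"
    have inv_eq: "f (X u) = f (Y u)" if "f \<in> invariants" for f
      using zero S_sep[of "X u" "Y u"] that by simp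
    have X1: "X u $ k1 = diag_mat d" by (simp add: X_def vec_eq_iff)
    \<comment> \<open>The perturbation of the \<open>k1\<close>-th matrix has to be removed before
      anything else: closed walks are available only when both tuples have \<open>diag_mat d\<close>
      there.\<close>
    have "Y u $ k1 = diag_mat d + (\<chi> i j. u (k1, j, j))" by (simp add: Y_def vec_eq_iff)
    from rank_one_perturbation_eq_0[OF inv_eq d X1 this]
    have eps: "u (k1, i, i) = 0" for i by simp
    have Y1: "Y u $ k1 = diag_mat d" by (simp add: Y_def vec_eq_iff eps)
    note cyc = invariants_eq_imp_cycles_eq[OF inv_eq d X1 Y1]
    define x where "x k i j = X u $ k $ i $ j" for k i j
    define y where "y k i j = Y u $ k $ i $ j" for k i j
    have cyc2: "x k i j * x k' j i = y k i j * y k' j i" for k k' i j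
      unfolding x_def y_def by (rule cyc(2))
    have cyc3: "x k i j * x k' j l * x k'' l i = y k i j * y k' j l * y k'' l i" for k k' k'' i j l
      unfolding x_def y_def by (rule cyc(3))
    have x_middle: "x k i j = 1" if "k \<noteq> k1" "i \<in> M" "j \<in> M" "i \<noteq> j" for k i j
      using that by (auto simp: x_def X_def upper_def base_def M_def)
    have y_star: "y k2 m0 j = 1" if "j \<in> M" "j \<noteq> m0" for j
      using that k2 m0 by (auto simp: y_def Y_def upper_def base_def M_def I_def U_def)
    have y_middle: "y k i j = 1" if "k \<noteq> k1" "i \<in> M" "j \<in> M" "i \<noteq> j" for k i j
      by (rule cycles_eq_imp_middle_eq_1[of k1 x y M m0 k2, OF cyc2 cyc3 x_middle m0 k2 y_star that])
    have upx: "x ks a js = 1" "x ks js b = 1" "x kt a jt = 0" "x kt jt b = 0"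
      using \<sigma>\<tau>(3) ks kt abm(1) by (auto simp: x_def X_def upper_def base_def st)
    have upy: "y kt a jt = 1" "y kt jt b = 1" "y ks a js = 0" "y ks js b = 0"
      using \<sigma>\<tau>(3) ks kt abm(1) by (auto simp: y_def Y_def upper_def base_def st)
    have notin: "i \<in> M \<longleftrightarrow> i \<notin> {a, b}" for i by (simp add: M_def)
    \<comment> \<open>The argument is used twice with exchanged roles: at \<open>\<sigma>\<close>
      the upper entries of \<open>x\<close> are \<open>1\<close> and those of \<open>y\<close> are
      \<open>0\<close>, at \<open>\<tau>\<close> it is the reverse. This is where two different
      positions are required.\<close>
    note x0 = cycles_eq_imp_lower_eq_0[of k1 x y a b ks js, OF cyc2 cyc3 x_middle[unfolded notin] ks upx(1,2) upy(3,4)]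
    note y0 = cycles_eq_imp_lower_eq_0[of k1 y x a b kt jt, OF cyc2[symmetric] cyc3[symmetric]
        y_middle[unfolded notin] kt upy(1,2) upx(3,4)]
    have x_low: "x k i j = 0" if "k \<noteq> k1" "upper a b j i" for k i j
      using that x0[of k] by (cases "j = a"; cases "i = b") (auto simp: upper_def)
    have y_low: "y k i j = 0" if "k \<noteq> k1" "upper a b j i" for k i j
      using that y0[of k] by (cases "j = a"; cases "i = b") (auto simp: upper_def)
    obtain k i j where kij: "v = (k, i, j)" by (rule prod_cases3)
    show "u v = 0"
    proof (cases "k = k1")
      case True
      then have "i = j" using v kij by (auto simp: I_def U_def)
      then show ?thesis using eps True kij by simp
    next
      case False
      show ?thesis
      proof (cases "upper a b i j")
        case True
        then have "x k j i = 0" using x_low False by blast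
        then show ?thesis using True False by (simp add: x_def X_def kij)
      next
        case upp: False
        have yu: "y k i j = u v + base \<tau> k i j" using upp False v by (simp add: y_def Y_def kij)
        consider "i = j" | "i \<noteq> j" "upper a b j i" | "i \<noteq> j" "i \<in> M" "j \<in> M"
          using upp by (auto simp: upper_def M_def)
        then show ?thesis
        proof cases
          case 1
          have "X u $ k $ i $ i = Y u $ k $ i $ i" by (rule cyc(1))
          then have "y k i i = 0" using False by (simp add: y_def X_def upper_def base_def)
          then show ?thesis using yu 1 by (simp add: base_def)
        next
          case 2
          then have "base \<tau> k i j = 0" using upp by (auto simp: base_def upper_def)
          then show ?thesis using yu y_low[OF False 2(2)] by simp
        next
          case 3
          then have "base \<tau> k i j = 1" by (auto simp: base_def M_def)
          then show ?thesis using yu y_middle[OF False 3(2,3,1)] by simp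
        qed
      qed
    qed
  qed
  then show ?thesis by (simp add: cardI)
qed

theorem mainTheorem4:
  assumes "(CARD('n::finite) \<ge> 2 \<and> CARD('p::finite) \<ge> 4) \<or> (CARD('n) \<ge> 3 \<and> CARD('p) = 3)"
  shows "\<not> (\<exists>S :: (('p, 'n) mat_tuple \<Rightarrow> complex) set. polynomial_separating_set S) \<and>
         \<not> (\<exists>S :: (('p, 'n) mat_tuple \<Rightarrow> complex) set. hypersurface_separating_set S)"
proof -
  let ?D = "(CARD('n) - 1) * CARD('p)\<^sup>2 + 1"
  let ?R = "invariant_ring :: (('p, 'n) mat_tuple \<Rightarrow> complex) ring"
  have "2 \<le> CARD('n)" using assms by auto
  from krull_dim_invariant_ring[OF this] have dim: "krull_dim ?R \<le> enat ?D" .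
  \<comment> \<open>One inequality serves both claims: a polynomial or hypersurface separating set
    has at most \<open>krull_dim ?R + 1\<close> elements, while every finite separating set has at
    least \<open>?D + 2\<close>.\<close>
  have "\<not> enat (card S) \<le> krull_dim ?R + 1"
    if "separating_set S" "finite S" for S :: "(('p, 'n) mat_tuple \<Rightarrow> complex) set"
  proof
    assume "enat (card S) \<le> krull_dim ?R + 1"
    also have "\<dots> \<le> enat ?D + 1" using dim by (rule add_right_mono)
    also have "\<dots> = enat (?D + 1)" by (simp add: one_enat_def)
    finally show False using separating_set_card_ge[OF assms that] by simp
  qed
  moreover have "krull_dim ?R \<le> krull_dim ?R + 1" by (simp add: one_enat_def)
  ultimately show ?thesis
    unfolding polynomial_separating_set_def hypersurface_separating_set_def
    by (metis order_refl)
qed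

end
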